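(* Let $H$ be a finite linear $s$-uniform hypergraph whose line graph is a cograph. Suppose $R_s(H)\le D\le s-1$ and that $\operatorname{Comp}(s,D)$ holds. Then, after isolated vertices are removed: (a) $H$ is the vertex-disjoint union of connected components, each of which is an affine plane of order $s$, a component whose incidence matrix has full row rank, or an affine-plane subsystem. Here a component $F$ with $R_s(F)=d$ is an affine-plane subsystem with parameter $h$ ($0\le h\le d$) if there is a unique affine plane $\Pi$ of order $s$ with $F\subseteq\Pi$ such that $F$ contains every line in $s+1-h$ parallel classes of $\Pi$ and exactly $d-h$ additional lines from the remaining $h$ classes. The positive values among the component defects $R_s(F)$ sum to at most $D$. (b) One can delete at most $D$ edges from $H$ so that the result (isolated vertices removed) is a vertex-disjoint union of finite nets of order $s$ and affine planes of order $s$. (c) Alternatively, deleting the full-row-rank components and completing every geometric component (affine plane or affine-plane subsystem) to its affine plane requires at most $sD$ added lines in total. For one geometric component of defect $d$ and parameter $h$, the exact number of added lines is $$hs-(d-h)=h(s+1)-d.$$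
   Context: A hypergraph is $s$-uniform if every edge has exactly $s$ vertices, and linear if any two distinct edges share at most one vertex. The line graph has the edges of the hypergraph as vertices, two distinct edges being adjacent when they intersect. A cograph is a graph with no induced path on four vertices. $N(H)$ is the edge--vertex incidence matrix (rows indexed by edges; isolated vertices removed), and the incidence-rank defect is $$R_s(H)=(s+1)\operatorname{rank}_{\mathbb R}N(H)-s|E(H)|.$$ An $a$-net of order $s$ is a linear $s$-uniform incidence structure on $s^2$ points whose lines are divided into $a$ parallel classes; each class consists of $s$ disjoint lines partitioning the point set, and lines from different classes meet in exactly one point. Its deficiency is $s+1-a$. An affine plane of order $s$ is an $(s+1)$-net of order $s$ (so it has parameter $h=0$ and defect $0$). $F\subseteq\Pi$ means that every edge of $F$ is a line of $\Pi$. Completion hypothesis: for $0\le d\le s-1$, $\operatorname{Comp}(s,d)$ means that (i) every net of order $s$ and deficiency at most $d$ embeds in an affine plane of order $s$ (on the same point set, its parallel classes being parallel classes of the plane), and (ii) $s>(d-1)^2$. *)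

theory Defs
  imports "HOL-Analysis.Analysis" "HOL-Library.Disjoint_Sets"
begin

text \<open>
  A hypergraph is given by its set of edges, a set of vertex sets. Its non-isolated vertices are
  \<open>\<Union>E\<close>, so passing to a set of edges already removes the isolated vertices. Where the ambient
  vertex type has class \<open>finite\<close>, its elements outside \<open>\<Union>E\<close> are the isolated vertices.
\<close>

definition uniform :: "nat \<Rightarrow> 'a set set \<Rightarrow> bool" where
  "uniform s E \<longleftrightarrow> (\<forall>e\<in>E. finite e \<and> card e = s)"

definition linear_hypergraph :: "'a set set \<Rightarrow> bool" where
  "linear_hypergraph E \<longleftrightarrow> (\<forall>e\<in>E. \<forall>f\<in>E. e \<noteq> f \<longrightarrow> card (e \<inter> f) \<le> 1)"

definition line_adj :: "'a set \<Rightarrow> 'a set \<Rightarrow> bool" where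
  "line_adj e f \<longleftrightarrow> e \<noteq> f \<and> e \<inter> f \<noteq> {}"

definition cograph :: "'b set \<Rightarrow> ('b \<Rightarrow> 'b \<Rightarrow> bool) \<Rightarrow> bool" where
  "cograph V adj \<longleftrightarrow>
     \<not> (\<exists>a\<in>V. \<exists>b\<in>V. \<exists>c\<in>V. \<exists>d\<in>V. distinct [a, b, c, d] \<and>
          adj a b \<and> adj b c \<and> adj c d \<and> \<not> adj a c \<and> \<not> adj a d \<and> \<not> adj b d)"

text \<open>
  Connected components, as sets of edges: two edges lie in the same component iff they are joined
  by a chain of edges of \<open>E\<close> in which consecutive ones intersect.
\<close>

definition components_of_hypergraph :: "'a set set \<Rightarrow> 'a set set set" where
  "components_of_hypergraph E =
     (\<lambda>e. {(f, g). f \<in> E \<and> g \<in> E \<and> line_adj f g}\<^sup>* `` {e}) ` E"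

definition vertex_disjoint :: "'a set set set \<Rightarrow> bool" where
  "vertex_disjoint \<F> \<longleftrightarrow> pairwise (\<lambda>F G. disjnt (\<Union>F) (\<Union>G)) \<F>"

text \<open>
  The rows of the incidence matrix are indexed by all vertex sets, those of non-edges being zero,
  and the columns by all vertices, those of isolated vertices being zero. The zero rows and columns
  do not affect the rank, and they let one matrix type serve all hypergraphs on a vertex type.
\<close>

definition incidence_matrix :: "'v::finite set set \<Rightarrow> real^'v^('v set)" where
  "incidence_matrix E = (\<chi> e v. if e \<in> E \<and> v \<in> e then 1 else 0)"

definition incidence_rank :: "'v::finite set set \<Rightarrow> nat" where
  "incidence_rank E = rank (incidence_matrix E)"

definition rank_defect :: "nat \<Rightarrow> 'v::finite set set \<Rightarrow> int" where
  "rank_defect s E = (int s + 1) * int (incidence_rank E) - int s * int (card E)"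

definition full_row_rank :: "'v::finite set set \<Rightarrow> bool" where
  "full_row_rank E \<longleftrightarrow> incidence_rank E = card E"

text \<open>\<open>net s a P \<C>\<close>: an \<open>a\<close>-net of order \<open>s\<close> with point set \<open>P\<close> and set of parallel classes
  \<open>\<C>\<close>; its set of lines is \<open>\<Union>\<C>\<close>.\<close>

definition net :: "nat \<Rightarrow> nat \<Rightarrow> 'a set \<Rightarrow> 'a set set set \<Rightarrow> bool" where
  "net s a P \<C> \<longleftrightarrow>
     finite P \<and> card P = s\<^sup>2 \<and> card \<C> = a \<and>
     uniform s (\<Union>\<C>) \<and> linear_hypergraph (\<Union>\<C>) \<and>
     (\<forall>c\<in>\<C>. partition_on P c \<and> card c = s) \<and>
     (\<forall>c\<in>\<C>. \<forall>c'\<in>\<C>. c \<noteq> c' \<longrightarrow> (\<forall>l\<in>c. \<forall>m\<in>c'. card (l \<inter> m) = 1))"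

definition deficiency :: "nat \<Rightarrow> nat \<Rightarrow> int" where
  "deficiency s a = int s + 1 - int a"

text \<open>The next two predicates are about sets of lines; the points are those on some line.\<close>

definition is_net :: "nat \<Rightarrow> 'a set set \<Rightarrow> bool" where
  "is_net s L \<longleftrightarrow> (\<exists>a \<C>. net s a (\<Union>L) \<C> \<and> L = \<Union>\<C>)"

definition is_affine_plane :: "nat \<Rightarrow> 'a set set \<Rightarrow> bool" where
  "is_affine_plane s L \<longleftrightarrow> (\<exists>\<C>. net s (s + 1) (\<Union>L) \<C> \<and> L = \<Union>\<C>)"

text \<open>
  The completion hypothesis speaks about all nets of order \<open>s\<close>. These are finite, so up to
  isomorphism their points are natural numbers; this keeps the hypothesis independent of the
  vertex type of the hypergraph under consideration.
\<close>

definition Comp :: "nat \<Rightarrow> nat \<Rightarrow> bool" where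
  "Comp s d \<longleftrightarrow>
     (\<forall>a (P :: nat set) \<C>. net s a P \<C> \<and> deficiency s a \<le> int d \<longrightarrow>
        (\<exists>\<C>'. net s (s + 1) P \<C>' \<and> \<C> \<subseteq> \<C>')) \<and>
     int s > (int d - 1)\<^sup>2"

text \<open>
  \<open>K\<close> consists of \<open>s + 1 - h\<close> parallel classes of the plane with all lines in \<open>F\<close>. Uniqueness of
  the plane is among all affine planes of order \<open>s\<close> containing \<open>F\<close>.
\<close>

definition affine_subsystem :: "nat \<Rightarrow> nat \<Rightarrow> 'v::finite set set \<Rightarrow> bool" where
  "affine_subsystem s h F \<longleftrightarrow>
     int h \<le> rank_defect s F \<and>
     (\<exists>!L. is_affine_plane s L \<and> F \<subseteq> L) \<and>
     (\<exists>L \<C> K. net s (s + 1) (\<Union>L) \<C> \<and> L = \<Union>\<C> \<and> F \<subseteq> L \<and>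
        K \<subseteq> \<C> \<and> card K + h = s + 1 \<and> \<Union>K \<subseteq> F \<and>
        int (card (F - \<Union>K)) = rank_defect s F - int h)"

definition has_parameter :: "nat \<Rightarrow> nat \<Rightarrow> 'v::finite set set \<Rightarrow> bool" where
  "has_parameter s h F \<longleftrightarrow> is_affine_plane s F \<and> h = 0 \<or> affine_subsystem s h F"

definition geometric_components :: "nat \<Rightarrow> 'v::finite set set \<Rightarrow> 'v set set set" where
  "geometric_components s E = {F \<in> components_of_hypergraph E. \<exists>h. has_parameter s h F}"

definition plane_completion :: "nat \<Rightarrow> 'a set set \<Rightarrow> 'a set set" where
  "plane_completion s F = (THE L. is_affine_plane s L \<and> F \<subseteq> L)"

end

(* The row kernel of the incidence matrix N consists of the edge weightings x with sum 0 at every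
   vertex. For such x the total weight is 0, so N N^T x = 0 turns into B x = 0 with
   B e f = |e \<inter> f| - 1, a matrix whose off-diagonal entries are -1 for disjoint edges and 0 for
   intersecting ones. Hence B is block diagonal over the co-components, the connected components of
   the complement of the line graph. A connected cograph on at least two vertices has at least two
   co-components.

   If some kernel vector has nonzero sum on a co-component, then positivity of N N^T makes every
   block positive semidefinite, and Perron-Frobenius shows that kernel vectors are determined by
   their block sums and that every block in the support has at least s edges, with equality only
   for s disjoint edges. This gives defect at least s + 1 - a, where a is the number of blocks of the
   latter kind; those form a net on all vertices. Otherwise the kernel lives on smaller connected
   pieces, and induction shows that the defect is at least s.

   When the defect is at most D, the net extends to a plane, all remaining edges are transversals
   of the net, and by Bruck's counting argument they are lines of the plane. *)
theory Submission
  imports Defs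
begin

section \<open>Connected components and cographs\<close>

text \<open>The defect equals |E| - (s+1) n with n the dimension of the row kernel, so everything
  rests on two bounds for n in a component. If some kernel vector has a nonzero block sum and k
  blocks support kernel vectors, then n <= k - 1: each block has at most one degree of freedom, and
  the vanishing total weight removes one more. Conversely, two full parallel classes of a plane give
  the relation "sum of one minus sum of the other", so n >= m - 1 for m full classes. Once the plane
  is found, the k blocks turn out to be among the m full classes. Both bounds are then equalities,
  which makes h and the number of additional lines exact.

  The obstacle is that blocks are known to be positive semidefinite only if a kernel vector with
  nonzero block sum exists: multiples of it correct a weighting of another block to total weight 0,
  where B agrees with N N^T. If all block sums vanish, kernel vectors are instead cut up along the
  components of the blocks. The bound D <= s - 1 excludes the outcome of that case.\<close>

definition rel_components :: "'b set \<Rightarrow> ('b \<Rightarrow> 'b \<Rightarrow> bool) \<Rightarrow> 'b set set" where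
  "rel_components V P = (\<lambda>e. {(f, g). f \<in> V \<and> g \<in> V \<and> P f g}\<^sup>* `` {e}) ` V"

text \<open>Connectivity as a condition on cuts, the form in which it is used: to spread a property
  through a component and to contradict a cograph split. Sets with at most one element are
  connected.\<close>

definition cut_connected :: "'b set \<Rightarrow> ('b \<Rightarrow> 'b \<Rightarrow> bool) \<Rightarrow> bool" where
  "cut_connected V P \<longleftrightarrow>
     (\<forall>A. A \<subseteq> V \<and> A \<noteq> {} \<and> A \<noteq> V \<longrightarrow> (\<exists>a\<in>A. \<exists>b\<in>V - A. P a b))"

text \<open>Taken with \<open>line_adj\<close>, \<open>rel_components\<close> gives the connected
  components; taken with \<open>disjnt\<close>, it gives the co-components. Both share the lemmas
  below.\<close>

lemma components_of_hypergraph_eq: "components_of_hypergraph E = rel_components E line_adj"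
  by (simp add: components_of_hypergraph_def rel_components_def)

lemma rel_component_eqI:
  assumes "symp P" "C \<in> rel_components V P" "a \<in> C"
  shows "C = {(f, g). f \<in> V \<and> g \<in> V \<and> P f g}\<^sup>* `` {a}"
proof -
  let ?r = "{(f, g). f \<in> V \<and> g \<in> V \<and> P f g}"
  have "sym ?r"
    using assms(1) by (auto simp: sym_def symp_def)
  then have sym: "sym (?r\<^sup>*)"
    by (rule sym_rtrancl)
  obtain e where e: "C = ?r\<^sup>* `` {e}"
    using assms(2) unfolding rel_components_def by blast
  have ea: "(e, a) \<in> ?r\<^sup>*"
    using assms(3) e by blast
  then have ae: "(a, e) \<in> ?r\<^sup>*"
    using sym by (rule symD[rotated])
  have "(e, x) \<in> ?r\<^sup>* \<longleftrightarrow> (a, x) \<in> ?r\<^sup>*" for x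
    using rtrancl_trans[OF ea] rtrancl_trans[OF ae] by blast
  then show ?thesis
    unfolding e by blast
qed

lemma rel_component_subset:
  assumes "C \<in> rel_components V P"
  shows "C \<subseteq> V"
proof -
  let ?r = "{(f, g). f \<in> V \<and> g \<in> V \<and> P f g}"
  obtain e where e: "e \<in> V" "C = ?r\<^sup>* `` {e}"
    using assms unfolding rel_components_def by blast
  have "x \<in> V" if "(e, x) \<in> ?r\<^sup>*" for x
    using that e(1) by (induction rule: rtrancl_induct) auto
  then show ?thesis using e by blast
qed

lemma rel_components_disjoint:
  assumes "symp P" "C \<in> rel_components V P" "D \<in> rel_components V P" "C \<noteq> D"
  shows "C \<inter> D = {}"
  using rel_component_eqI[OF assms(1,2)] rel_component_eqI[OF assms(1,3)] assms(4) by blast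

lemma partition_on_rel_components:
  assumes "symp P"
  shows "partition_on V (rel_components V P)"
proof (rule partition_onI)
  show "\<Union>(rel_components V P) = V"
    using rel_component_subset[of _ V P] by (auto simp: rel_components_def)
  show "disjnt p q" if "p \<in> rel_components V P" "q \<in> rel_components V P" "p \<noteq> q" for p q
    using rel_components_disjoint[OF assms that] by (simp add: disjnt_def)
  show "{} \<notin> rel_components V P"
    by (auto simp: rel_components_def)
qed

lemma rel_component_exists:
  assumes "e \<in> V"
  obtains C where "C \<in> rel_components V P" "e \<in> C"
  using that[of "{(f, g). f \<in> V \<and> g \<in> V \<and> P f g}\<^sup>* `` {e}"] assms
  by (simp add: rel_components_def)

lemma rel_components_separated:
  assumes "symp P" "C \<in> rel_components V P" "D \<in> rel_components V P" "C \<noteq> D" "a \<in> C" "b \<in> D"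
  shows "\<not> P a b"
proof
  assume "P a b"
  moreover have "a \<in> V" "b \<in> V"
    using assms rel_component_subset by blast+
  ultimately have "b \<in> C"
    using rel_component_eqI[OF assms(1,2,5)] by blast
  then show False
    using rel_components_disjoint[OF assms(1-4)] assms(6) by blast
qed

lemma cut_connected_rel_component:
  assumes "symp P" "C \<in> rel_components V P"
  shows "cut_connected C P"
  unfolding cut_connected_def
proof (intro allI impI, rule ccontr)
  fix A
  let ?r = "{(f, g). f \<in> V \<and> g \<in> V \<and> P f g}"
  assume A: "A \<subseteq> C \<and> A \<noteq> {} \<and> A \<noteq> C" and no: "\<not> (\<exists>a\<in>A. \<exists>b\<in>C - A. P a b)"
  obtain a where a: "a \<in> A" using A by blast
  then have C: "C = ?r\<^sup>* `` {a}"
    using rel_component_eqI[OF assms] A by blast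
  have "x \<in> A" if "(a, x) \<in> ?r\<^sup>*" for x
    using that
  proof (induction rule: rtrancl_induct)
    case base
    show ?case by (rule a)
  next
    case (step y z)
    then have "z \<in> C"
      unfolding C by (auto intro: rtrancl_into_rtrancl)
    then show ?case
      using step no by blast
  qed
  then show False
    using A C by blast
qed

lemma rel_components_split:
  assumes "symp P" "\<not> cut_connected V P" "C \<in> rel_components V P"
  obtains D where "D \<in> rel_components V P" "D \<noteq> C"
proof -
  have "C \<noteq> V"
    using assms cut_connected_rel_component by blast
  moreover have "C \<subseteq> V" "V = \<Union>(rel_components V P)"
    using assms partition_onD1[OF partition_on_rel_components] rel_component_subset by blast+
  ultimately show ?thesis
    using that by blast
qed

text \<open>Having no induced path on four vertices is invariant under complementation, so in the
  induction step the graph without \<open>v\<close> may be assumed to be disconnected.\<close>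

lemma cograph_split_aux:
  assumes "symp adj" "cograph V adj" "v \<in> V" "A \<subseteq> V - {v}" "A \<noteq> {}" "A \<noteq> V - {v}"
    and no: "\<forall>a\<in>A. \<forall>b\<in>V - {v} - A. \<not> adj a b"
  shows "\<exists>A\<subseteq>V. A \<noteq> {} \<and> A \<noteq> V \<and>
           ((\<forall>a\<in>A. \<forall>b\<in>V - A. \<not> adj a b) \<or> (\<forall>a\<in>A. \<forall>b\<in>V - A. adj a b))"
proof -
  define B where "B = V - {v} - A"
  have sym: "adj x y \<longleftrightarrow> adj y x" for x y
    using assms(1) by (auto simp: symp_def)
  have V: "V = insert v (A \<union> B)" "v \<notin> A" "v \<notin> B" "A \<inter> B = {}" "B \<noteq> {}"
    using assms(3-6) by (auto simp: B_def)
  have AB: "\<not> adj a b" "\<not> adj b a" if "a \<in> A" "b \<in> B" for a b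
    using no that sym by (auto simp: B_def)
  have P4: False if "distinct [a, b, c, d]" "a \<in> V" "b \<in> V" "c \<in> V" "d \<in> V"
    "adj a b" "adj b c" "adj c d" "\<not> adj a c" "\<not> adj a d" "\<not> adj b d" for a b c d
    using assms(2) that unfolding cograph_def by blast
  \<comment> \<open>If v has no neighbour in B', then B' is cut off. Otherwise let z in B' be a
    neighbour of v. The set X of non-neighbours of v in A' is then cut off, since an edge from x in
    X to a neighbour y of v in A' would give the induced path z, v, y, x.\<close>
  have part: ?thesis
    if V': "V = insert v (A' \<union> B')" "v \<notin> A'" "v \<notin> B'" "A' \<inter> B' = {}" "B' \<noteq> {}"
      and AB': "\<And>a b. a \<in> A' \<Longrightarrow> b \<in> B' \<Longrightarrow> \<not> adj a b \<and> \<not> adj b a"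
      and w: "w \<in> A'" "\<not> adj v w" for A' B' w
  proof (cases "\<exists>z\<in>B'. adj v z")
    case False
    then show ?thesis
      by (intro exI[of _ B']) (use V' AB' w in \<open>auto simp: sym[of _ v]\<close>)
  next
    case True
    then obtain z where z: "z \<in> B'" "adj v z" by blast
    define X where "X = {x \<in> A'. \<not> adj v x}"
    have X: "\<not> adj x y" if "x \<in> X" "y \<in> A' - X" for x y
    proof
      assume "adj x y"
      moreover have "distinct [z, v, y, x]"
        using that z w V' unfolding X_def by auto
      moreover have "adj z v" "adj v y" "\<not> adj z y" "\<not> adj z x" "\<not> adj v x" "adj y x"
        using z that AB' sym[of z v] sym[of y x] \<open>adj x y\<close> unfolding X_def by auto
      ultimately show False
        using P4[of z v y x] that z V' unfolding X_def by blast
    qed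
    then have "\<not> adj x y" if "x \<in> X" "y \<in> V - X" for x y
    proof -
      consider "y = v" | "y \<in> A' - X" | "y \<in> B'"
        using \<open>y \<in> V - X\<close> V'(1) by blast
      then show ?thesis
      proof cases
        case 1
        then show ?thesis
          using \<open>x \<in> X\<close> sym[of x v] by (simp add: X_def)
      next
        case 2
        then show ?thesis
          by (rule X[OF \<open>x \<in> X\<close>])
      next
        case 3
        then show ?thesis
          using \<open>x \<in> X\<close> AB'[of x y] by (simp add: X_def)
      qed
    qed
    then show ?thesis
      by (intro exI[of _ X]) (use V' w in \<open>auto simp: X_def\<close>)
  qed
  show ?thesis
  proof (cases "\<exists>w\<in>A \<union> B. \<not> adj v w")
    case True
    then obtain w where "w \<in> A \<union> B" "\<not> adj v w" by blast
    then show ?thesis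
      using part[of A B w] part[of B A w] V AB assms(5) by (auto simp: Un_commute Int_commute)
  next
    case False
    then show ?thesis
      by (intro exI[of _ "{v}"]) (use V in auto)
  qed
qed

text \<open>The complement of the induced path a, b, c, d is the path b, d, a, c.\<close>

lemma cograph_complement:
  assumes "symp adj" "cograph V adj"
  shows "cograph V (\<lambda>x y. \<not> adj x y)"
  unfolding cograph_def
proof (intro notI, elim bexE conjE)
  fix a b c d
  assume *: "a \<in> V" "b \<in> V" "c \<in> V" "d \<in> V" "distinct [a, b, c, d]"
    "\<not> adj a b" "\<not> adj b c" "\<not> adj c d" "\<not> \<not> adj a c" "\<not> \<not> adj a d" "\<not> \<not> adj b d"
  then have "adj b d" "adj d a" "adj a c" "\<not> adj b a" "\<not> adj b c" "\<not> adj d c" "distinct [b, d, a, c]"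
    using assms(1) by (auto simp: symp_def)
  then show False
    using * assms(2) unfolding cograph_def by blast
qed

lemma cograph_mono: "cograph V adj \<Longrightarrow> W \<subseteq> V \<Longrightarrow> cograph W adj"
  unfolding cograph_def by blast

text \<open>Induction on the number of vertices: the graph without v splits by a cut, and
  \<open>cograph_split_aux\<close> puts v back, applied to the graph or to its complement according
  to the kind of cut.\<close>

lemma cograph_split:
  assumes "finite V" "symp adj" "cograph V adj" "2 \<le> card V"
  shows "\<exists>A\<subseteq>V. A \<noteq> {} \<and> A \<noteq> V \<and>
           ((\<forall>a\<in>A. \<forall>b\<in>V - A. \<not> adj a b) \<or> (\<forall>a\<in>A. \<forall>b\<in>V - A. adj a b))"
  using assms
proof (induction "card V" arbitrary: V rule: less_induct)
  case less
  obtain v where v: "v \<in> V"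
    using less.prems(4) by fastforce
  show ?case
  proof (cases "2 \<le> card (V - {v})")
    case False
    then have "card (V - {v}) = 1"
      using less.prems v by simp
    then obtain u where "V - {v} = {u}"
      by (auto simp: card_1_singleton_iff)
    then have "V = {v, u}" "u \<noteq> v"
      using v by auto
    then show ?thesis
      by (intro exI[of _ "{v}"]) auto
  next
    case True
    have "card (V - {v}) < card V"
      using v less.prems(1) by (rule card_Diff1_less[rotated])
    then obtain A where A: "A \<subseteq> V - {v}" "A \<noteq> {}" "A \<noteq> V - {v}"
      and or: "(\<forall>a\<in>A. \<forall>b\<in>V - {v} - A. \<not> adj a b) \<or> (\<forall>a\<in>A. \<forall>b\<in>V - {v} - A. adj a b)"
      using less.hyps[of "V - {v}"] less.prems(1,2) True cograph_mono[OF less.prems(3) Diff_subset]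
      by auto
    from or show ?thesis
    proof
      assume "\<forall>a\<in>A. \<forall>b\<in>V - {v} - A. \<not> adj a b"
      then show ?thesis
        using cograph_split_aux[OF less.prems(2,3) v A] by blast
    next
      assume *: "\<forall>a\<in>A. \<forall>b\<in>V - {v} - A. adj a b"
      have "symp (\<lambda>x y. \<not> adj x y)"
        using less.prems(2) by (auto simp: symp_def)
      then show ?thesis
        using cograph_split_aux[of "\<lambda>x y. \<not> adj x y", OF _ cograph_complement v A] * less.prems
        by blast
    qed
  qed
qed

text \<open>\<open>nadj\<close> stands for \<open>disjnt\<close>. It is only asked to be
  incompatible with \<open>adj\<close> on distinct vertices, because \<open>disjnt\<close> is not
  the full complement of \<open>line_adj\<close>: both fail on the pair of a nonempty edge with
  itself.\<close>

lemma cograph_not_both_connected: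
  assumes "finite V" "symp adj" "cograph V adj" "2 \<le> card V" "cut_connected V adj"
    and "\<And>x y. \<lbrakk>x \<in> V; y \<in> V; nadj x y; x \<noteq> y\<rbrakk> \<Longrightarrow> \<not> adj x y"
  shows "\<not> cut_connected V nadj"
proof
  assume co: "cut_connected V nadj"
  obtain A where A: "A \<subseteq> V" "A \<noteq> {}" "A \<noteq> V"
    and or: "(\<forall>a\<in>A. \<forall>b\<in>V - A. \<not> adj a b) \<or> (\<forall>a\<in>A. \<forall>b\<in>V - A. adj a b)"
    using cograph_split[OF assms(1-4)] by blast
  obtain a b a' b' where "a \<in> A" "b \<in> V - A" "adj a b" "a' \<in> A" "b' \<in> V - A" "nadj a' b'"
    using co assms(5) A unfolding cut_connected_def by meson
  then show False
    using or assms(6)[of a' b'] A by blast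
qed

section \<open>Rank and independent rows\<close>

text \<open>A vector of the row kernel of the incidence matrix of F. Only the values of x on F are
  constrained, so restricting a weighting means replacing F and keeping x.\<close>

definition balanced :: "'v set set \<Rightarrow> ('v set \<Rightarrow> real) \<Rightarrow> bool" where
  "balanced F x \<longleftrightarrow> (\<forall>v. (\<Sum>e | e \<in> F \<and> v \<in> e. x e) = 0)"

definition row_independent :: "'v set set \<Rightarrow> bool" where
  "row_independent F \<longleftrightarrow> (\<forall>x. balanced F x \<longrightarrow> (\<forall>e\<in>F. x e = 0))"

definition edge_vec :: "'v::finite set \<Rightarrow> real^'v" where
  "edge_vec e = (\<chi> v. if v \<in> e then 1 else 0)"

lemma inj_edge_vec: "inj edge_vec"
proof (rule injI)
  fix e f :: "'v::finite set"
  assume "edge_vec e = edge_vec f"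
  then have eq: "edge_vec e $ v = edge_vec f $ v" for v by simp
  have "v \<in> e \<longleftrightarrow> v \<in> f" for v
    using eq[of v]
    by (auto simp: edge_vec_def split: if_splits)
  then show "e = f" by blast
qed

text \<open>The rows of non-edges are zero, and zero vectors do not change the span.\<close>

lemma incidence_rank_eq_dim: "incidence_rank F = dim (edge_vec ` F)"
proof -
  have row: "row e (incidence_matrix F) = (if e \<in> F then edge_vec e else 0)" for e
    by (simp add: row_def incidence_matrix_def edge_vec_def vec_eq_iff)
  have "rows (incidence_matrix F) - {0} = edge_vec ` F - {0}"
    unfolding rows_def using row by (auto split: if_splits)
  then show ?thesis
    unfolding incidence_rank_def row_rank_def
    by (metis dim_span span_delete_0)
qed

lemma row_independent_iff: "row_independent F \<longleftrightarrow> independent (edge_vec ` F)"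
proof -
  have coord: "(\<Sum>e\<in>F. x e *\<^sub>R edge_vec e) $ v = (\<Sum>e | e \<in> F \<and> v \<in> e. x e)" for x v
    by (simp add: edge_vec_def if_distrib sum.If_cases Int_def cong: if_cong)
  have bal: "balanced F x \<longleftrightarrow> (\<Sum>e\<in>F. x e *\<^sub>R edge_vec e) = 0" for x
    unfolding balanced_def vec_eq_iff coord by simp
  have "independent (edge_vec ` F) \<longleftrightarrow>
    (\<forall>u. (\<Sum>w\<in>edge_vec ` F. u w *\<^sub>R w) = 0 \<longrightarrow> (\<forall>w\<in>edge_vec ` F. u w = 0))"
    using real_vector.dependent_finite[of "edge_vec ` F"] by auto
  also have "\<dots> \<longleftrightarrow> (\<forall>u. (\<Sum>e\<in>F. u (edge_vec e) *\<^sub>R edge_vec e) = 0 \<longrightarrow> (\<forall>e\<in>F. u (edge_vec e) = 0))"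
    by (simp add: sum.reindex inj_on_subset[OF inj_edge_vec])
  also have "\<dots> \<longleftrightarrow> row_independent F"
  proof -
    show ?thesis
      unfolding row_independent_def bal
    proof (intro iffI allI)
      fix x :: "'a set \<Rightarrow> real"
      assume *: "\<forall>u. (\<Sum>e\<in>F. u (edge_vec e) *\<^sub>R edge_vec e) = 0 \<longrightarrow>
        (\<forall>e\<in>F. u (edge_vec e) = 0)"
      show "(\<Sum>e\<in>F. x e *\<^sub>R edge_vec e) = 0 \<longrightarrow> (\<forall>e\<in>F. x e = 0)"
        using *[rule_format, of "x \<circ> inv edge_vec"] by (simp add: inj_edge_vec)
    next
      fix u :: "real^'a \<Rightarrow> real"
      assume *: "\<forall>x. (\<Sum>e\<in>F. x e *\<^sub>R edge_vec e) = 0 \<longrightarrow> (\<forall>e\<in>F. x e = 0)"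
      show "(\<Sum>e\<in>F. u (edge_vec e) *\<^sub>R edge_vec e) = 0 \<longrightarrow> (\<forall>e\<in>F. u (edge_vec e) = 0)"
        using *[THEN spec, of "\<lambda>e. u (edge_vec e)"] .
    qed
  qed
  finally show ?thesis by simp
qed

lemma card_row_independent_le_rank:
  assumes "row_independent G" "G \<subseteq> F"
  shows "card G \<le> incidence_rank F"
proof -
  have "card G = card (edge_vec ` G)"
    by (simp add: card_image inj_on_subset[OF inj_edge_vec])
  also have "\<dots> = dim (edge_vec ` G)"
    using assms(1) by (simp add: row_independent_iff dim_eq_card_independent)
  also have "\<dots> \<le> dim (edge_vec ` F)"
    using assms(2) by (intro dim_subset) auto
  finally show ?thesis by (simp add: incidence_rank_eq_dim)
qed

lemma row_basis_exists:
  obtains G where "G \<subseteq> F" "row_independent G" "card G = incidence_rank F"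
proof -
  obtain B where B: "B \<subseteq> edge_vec ` F" "independent B" "card B = dim (edge_vec ` F)"
    using basis_exists[of "edge_vec ` F"] by metis
  then obtain G where G: "G \<subseteq> F" "B = edge_vec ` G"
    by (meson subset_image_iff)
  then show ?thesis
    using that[of G] B by (simp add: row_independent_iff incidence_rank_eq_dim card_image
        inj_on_subset[OF inj_edge_vec])
qed

lemma incidence_rank_le_card: "incidence_rank F \<le> card F"
  by (metis row_basis_exists card_mono finite)

lemma full_row_rank_if_row_independent: "row_independent F \<Longrightarrow> full_row_rank F"
  unfolding full_row_rank_def
  by (simp add: antisym card_row_independent_le_rank incidence_rank_le_card)

lemma balanced_extend:
  fixes F :: "'v::finite set set"
  assumes "G \<subseteq> F"
  shows "balanced F (\<lambda>e. if e \<in> G then x e else 0) \<longleftrightarrow> balanced G x"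
proof -
  have "(\<Sum>e | e \<in> F \<and> v \<in> e. if e \<in> G then x e else 0) = (\<Sum>e | e \<in> G \<and> v \<in> e. x e)" for v
    by (rule sum.mono_neutral_cong_right) (use assms in auto)
  then show ?thesis
    by (simp add: balanced_def)
qed

text \<open>Rank is always subadditive over a partition. The reverse inequality holds when relations
  restrict to the parts: a relation among the united row bases, extended by 0, restricts to a
  relation within each basis and so vanishes.\<close>

lemma incidence_rank_superadditive:
  fixes F :: "'v::finite set set"
  assumes part: "partition_on F \<P>"
    and restrict: "\<And>x P. balanced F x \<Longrightarrow> P \<in> \<P> \<Longrightarrow> balanced P x"
  shows "(\<Sum>P\<in>\<P>. incidence_rank P) \<le> incidence_rank F"
proof -
  have "\<exists>G. G \<subseteq> P \<and> row_independent G \<and> card G = incidence_rank P" for P :: "'v set set"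
    by (metis row_basis_exists)
  then obtain b where b: "\<And>P :: 'v set set. b P \<subseteq> P" "\<And>P. row_independent (b P)"
    "\<And>P. card (b P) = incidence_rank P"
    by metis
  let ?G = "\<Union>(b ` \<P>)"
  have sub: "?G \<subseteq> F"
    using b(1) partition_onD1[OF part] by blast
  have disj: "P \<inter> Q = {}" if "P \<in> \<P>" "Q \<in> \<P>" "P \<noteq> Q" for P Q
    using partition_onD2[OF part] that by (auto simp: disjoint_def)
  have inter: "?G \<inter> P = b P" if "P \<in> \<P>" for P
    using b(1) disj that by blast
  have "row_independent ?G"
    unfolding row_independent_def
  proof (intro allI impI ballI)
    fix x e
    assume x: "balanced ?G x" and e: "e \<in> ?G"
    then obtain P where P: "P \<in> \<P>" "e \<in> b P" by blast
    have "balanced P (\<lambda>e. if e \<in> ?G then x e else 0)"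
      using restrict[OF _ P(1)] balanced_extend[OF sub] x by blast
    then have "balanced P (\<lambda>e. if e \<in> b P then x e else 0)"
    proof -
      have "(e \<in> ?G) = (e \<in> b P)" if "e \<in> P" for e
        using inter[OF P(1)] that by blast
      then have "(\<Sum>e | e \<in> P \<and> v \<in> e. if e \<in> ?G then x e else 0)
        = (\<Sum>e | e \<in> P \<and> v \<in> e. if e \<in> b P then x e else 0)" for v
        by (intro sum.cong) auto
      then show ?thesis
        using \<open>balanced P (\<lambda>e. if e \<in> ?G then x e else 0)\<close> unfolding balanced_def by simp
    qed
    then have "balanced (b P) x"
      using balanced_extend[OF b(1)] by blast
    then show "x e = 0"
      using b(2) P(2) unfolding row_independent_def by blast
  qed
  then have "card ?G \<le> incidence_rank F"
    by (rule card_row_independent_le_rank[OF _ sub])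
  moreover have "b P \<inter> b Q = {}" if "P \<in> \<P>" "Q \<in> \<P>" "P \<noteq> Q" for P Q
    using b(1)[of P] b(1)[of Q] disj[OF that] by blast
  then have "card ?G = (\<Sum>P\<in>\<P>. card (b P))"
    by (intro card_UN_disjoint) auto
  ultimately show ?thesis
    using b(3) by simp
qed

lemma card_partition_on:
  assumes "partition_on F \<P>" "finite F"
  shows "card F = (\<Sum>P\<in>\<P>. card P)"
proof -
  have "card (\<Union>\<P>) = sum card \<P>"
    using assms by (intro card_Union_disjoint)
      (auto simp: partition_on_def disjoint_def pairwise_def disjnt_def
        intro: finite_subset[of _ F])
  then show ?thesis
    using partition_onD1[OF assms(1)] by simp
qed

lemma rank_defect_superadditive:
  fixes F :: "'v::finite set set"
  assumes "partition_on F \<P>"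
    and "\<And>x P. balanced F x \<Longrightarrow> P \<in> \<P> \<Longrightarrow> balanced P x"
  shows "(\<Sum>P\<in>\<P>. rank_defect s P) \<le> rank_defect s F"
proof -
  have "int (\<Sum>P\<in>\<P>. incidence_rank P) \<le> int (incidence_rank F)"
    using incidence_rank_superadditive[OF assms] by (simp only: of_nat_le_iff)
  then have "(int s + 1) * (\<Sum>P\<in>\<P>. int (incidence_rank P)) \<le> (int s + 1) * int (incidence_rank F)"
    by (intro mult_left_mono) auto
  then show ?thesis
    unfolding rank_defect_def
    using card_partition_on[OF assms(1)]
    by (simp add: sum_subtractf sum_distrib_left[symmetric])
qed

section \<open>Perron-Frobenius for the co-components\<close>

text \<open>A null vector minimizes a positive semidefinite form, so the gradient there vanishes.
  The proof moves y along the coordinate e and compares the linear and quadratic terms.\<close>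

lemma psd_null_vector:
  fixes B :: "'b \<Rightarrow> 'b \<Rightarrow> real"
  assumes "finite C" and sym: "\<And>e f. B e f = B f e"
    and psd: "\<And>z. 0 \<le> (\<Sum>e\<in>C. \<Sum>f\<in>C. B e f * (z e * z f))"
    and null: "(\<Sum>e\<in>C. \<Sum>f\<in>C. B e f * (y e * y f)) \<le> 0"
    and e: "e \<in> C"
  shows "(\<Sum>f\<in>C. B e f * y f) = 0"
proof (rule ccontr)
  define r where "r = (\<Sum>f\<in>C. B e f * y f)"
  assume "(\<Sum>f\<in>C. B e f * y f) \<noteq> 0"
  then have r: "r \<noteq> 0" by (simp add: r_def)
  \<comment> \<open>This b is positive and at least \<open>B e e\<close>, even if that entry
    vanishes. With t = -r/b the form changes by at most -2 r^2/b + r^2/b < 0.\<close>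
  define b where "b = \<bar>B e e\<bar> + 1"
  define t where "t = - r / b"
  let ?d = "\<lambda>g. if g = e then 1 else (0::real)"
  have "(\<Sum>g\<in>C. \<Sum>f\<in>C. B g f * ((y g + t * ?d g) * (y f + t * ?d f))) =
      (\<Sum>g\<in>C. \<Sum>f\<in>C. B g f * (y g * y f)) + t * (\<Sum>g\<in>C. \<Sum>f\<in>C. B g f * ?d g * y f)
      + t * (\<Sum>g\<in>C. \<Sum>f\<in>C. B g f * y g * ?d f)
      + t\<^sup>2 * (\<Sum>g\<in>C. \<Sum>f\<in>C. B g f * ?d g * ?d f)"
    unfolding sum_distrib_left sum.distrib[symmetric]
    by (intro sum.cong refl) (simp add: algebra_simps power2_eq_square)
  also have "(\<Sum>g\<in>C. \<Sum>f\<in>C. B g f * ?d g * y f) = r"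
  proof -
    have "(\<Sum>g\<in>C. \<Sum>f\<in>C. B g f * ?d g * y f) = (\<Sum>g\<in>C. if g = e then \<Sum>f\<in>C. B g f * y f else 0)"
      by (intro sum.cong refl) auto
    then show ?thesis
      using assms(1) e by (simp add: r_def)
  qed
  also have "(\<Sum>g\<in>C. \<Sum>f\<in>C. B g f * y g * ?d f) = r"
    using assms(1) e by (simp add: r_def if_distrib[of "\<lambda>u. _ * u"] sym[of _ e] cong: if_cong)
  also have "(\<Sum>g\<in>C. \<Sum>f\<in>C. B g f * ?d g * ?d f) = B e e"
    using assms(1) e by (simp add: if_distrib[of "\<lambda>u. _ * u"] cong: if_cong)
  finally have "0 \<le> (\<Sum>g\<in>C. \<Sum>f\<in>C. B g f * (y g * y f)) + t * r + t * r + t\<^sup>2 * B e e"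
    using psd[of "\<lambda>g. y g + t * ?d g"] by simp
  then have "0 \<le> 2 * (t * r) + t\<^sup>2 * B e e"
    using null by linarith
  moreover have "t\<^sup>2 * B e e \<le> t\<^sup>2 * b"
    by (intro mult_left_mono) (auto simp: b_def)
  moreover have b: "b > 0"
    by (simp add: b_def)
  then have "t * r = - (r\<^sup>2 / b)" "t\<^sup>2 * b = r\<^sup>2 / b"
    by (auto simp: t_def power2_eq_square)
  moreover have "r\<^sup>2 / b > 0"
    using b r by simp
  ultimately show False by linarith
qed

section \<open>Kernel vectors of irreducible matrices with nonpositive off-diagonal entries\<close>

context
  fixes C :: "'b set" and B :: "'b \<Rightarrow> 'b \<Rightarrow> real" and P :: "'b \<Rightarrow> 'b \<Rightarrow> bool"
  assumes finite: "finite C"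
    and conn: "cut_connected C P"
    and edge_neg: "\<And>e f. \<lbrakk>e \<in> C; f \<in> C; P e f; e \<noteq> f\<rbrakk> \<Longrightarrow> B e f < 0"
    and off_diag: "\<And>e f. \<lbrakk>e \<in> C; f \<in> C; e \<noteq> f\<rbrakk> \<Longrightarrow> B e f \<le> 0"
begin

text \<open>In the row of an index where y vanishes all terms are nonpositive and sum to 0, so y
  also vanishes at every P-neighbour. By connectedness the zero set is everything.\<close>

lemma perron_nonneg_zero:
  assumes ker: "\<And>e. e \<in> C \<Longrightarrow> (\<Sum>f\<in>C. B e f * y f) = 0"
    and nonneg: "\<And>e. e \<in> C \<Longrightarrow> 0 \<le> y e"
    and zero: "e0 \<in> C" "y e0 = 0"
    and e: "e \<in> C"
  shows "y e = 0"
proof (rule ccontr)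
  define A where "A = {e \<in> C. y e = 0}"
  assume "y e \<noteq> 0"
  then have "A \<subseteq> C \<and> A \<noteq> {} \<and> A \<noteq> C"
    using zero e by (auto simp: A_def)
  then obtain a b where ab: "a \<in> A" "b \<in> C - A" "P a b"
    using conn unfolding cut_connected_def by blast
  have le: "B a f * y f \<le> 0" if "f \<in> C" for f
    using off_diag[of a f] nonneg[OF that] ab(1) that
    by (cases "a = f") (auto simp: A_def mult_nonpos_nonneg)
  have "(\<Sum>f\<in>C. B a f * y f) \<le> B a b * y b"
    using sum_mono2[of C "{b}" "\<lambda>f. - (B a f * y f)"] finite le ab(2) by (simp add: sum_negf)
  also have "\<dots> < 0"
  proof (rule mult_neg_pos)
    show "B a b < 0"
      using edge_neg[of a b] ab by (auto simp: A_def)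
    show "0 < y b"
      using nonneg[of b] ab(2) by (auto simp: A_def le_less)
  qed
  finally show False
    using ker[of a] ab(1) by (simp add: A_def)
qed

text \<open>Passing to absolute values keeps the diagonal terms and cannot increase the off-diagonal
  ones. The form at |x| is therefore at most 0, and |x| is again a null vector.\<close>

lemma perron_abs_ker:
  assumes sym: "\<And>e f. B e f = B f e"
    and psd: "\<And>z. 0 \<le> (\<Sum>e\<in>C. \<Sum>f\<in>C. B e f * (z e * z f))"
    and ker: "\<And>e. e \<in> C \<Longrightarrow> (\<Sum>f\<in>C. B e f * x f) = 0"
    and e: "e \<in> C"
  shows "(\<Sum>f\<in>C. B e f * \<bar>x f\<bar>) = 0"
proof (rule psd_null_vector[OF finite sym psd _ e])
  have "(\<Sum>e\<in>C. \<Sum>f\<in>C. B e f * (\<bar>x e\<bar> * \<bar>x f\<bar>)) \<le> (\<Sum>e\<in>C. \<Sum>f\<in>C. B e f * (x e * x f))"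
  proof (intro sum_mono)
    fix e f assume "e \<in> C" "f \<in> C"
    show "B e f * (\<bar>x e\<bar> * \<bar>x f\<bar>) \<le> B e f * (x e * x f)"
    proof (cases "e = f")
      case False
      have "x e * x f \<le> \<bar>x e\<bar> * \<bar>x f\<bar>"
        by (simp add: abs_mult[symmetric])
      then show ?thesis
        using off_diag[OF \<open>e \<in> C\<close> \<open>f \<in> C\<close> False] by (rule mult_left_mono_neg)
    qed (simp add: abs_mult[symmetric])
  qed
  also have "\<dots> = (\<Sum>e\<in>C. x e * (\<Sum>f\<in>C. B e f * x f))"
    by (simp add: sum_distrib_left algebra_simps)
  also have "\<dots> = 0"
    using ker by simp
  finally show "(\<Sum>e\<in>C. \<Sum>f\<in>C. B e f * (\<bar>x e\<bar> * \<bar>x f\<bar>)) \<le> 0" .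
qed

lemma perron_zero_if_zero_entry:
  assumes sym: "\<And>e f. B e f = B f e"
    and psd: "\<And>z. 0 \<le> (\<Sum>e\<in>C. \<Sum>f\<in>C. B e f * (z e * z f))"
    and ker: "\<And>e. e \<in> C \<Longrightarrow> (\<Sum>f\<in>C. B e f * x f) = 0"
    and zero: "e0 \<in> C" "x e0 = 0"
    and e: "e \<in> C"
  shows "x e = 0"
  using perron_nonneg_zero[of "\<lambda>e. \<bar>x e\<bar>", OF perron_abs_ker[OF sym psd ker] _ zero(1) _ e] zero(2)
  by auto

text \<open>The vector |x| + x is a nonnegative kernel vector. If it vanishes somewhere, it vanishes
  everywhere, so x <= 0 and the zero sum forces x = 0. If it vanishes nowhere, x is positive and its
  sum cannot be 0.\<close>

lemma perron_zero_if_sum_zero: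
  assumes sym: "\<And>e f. B e f = B f e"
    and psd: "\<And>z. 0 \<le> (\<Sum>e\<in>C. \<Sum>f\<in>C. B e f * (z e * z f))"
    and ker: "\<And>e. e \<in> C \<Longrightarrow> (\<Sum>f\<in>C. B e f * x f) = 0"
    and sum0: "(\<Sum>e\<in>C. x e) = 0"
    and e: "e \<in> C"
  shows "x e = 0"
proof (cases "\<exists>e0\<in>C. \<bar>x e0\<bar> + x e0 = 0")
  case True
  then obtain e0 where e0: "e0 \<in> C" "\<bar>x e0\<bar> + x e0 = 0" by blast
  have "(\<Sum>f\<in>C. B e f * (\<bar>x f\<bar> + x f)) = 0" if "e \<in> C" for e
    using perron_abs_ker[OF sym psd ker that] ker[OF that] by (simp add: distrib_left sum.distrib)
  then have "\<bar>x e\<bar> + x e = 0" if "e \<in> C" for e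
    using perron_nonneg_zero[of "\<lambda>e. \<bar>x e\<bar> + x e" e0 e] e0 that by auto
  then have "0 \<le> - x e" if "e \<in> C" for e
    using that by (metis abs_ge_zero add.commute add_0_left diff_add_cancel minus_add_cancel)
  then show ?thesis
    using sum_nonneg_eq_0_iff[of C "\<lambda>e. - x e"] finite sum0 e by (simp add: sum_negf)
next
  case False
  then have "0 < x e" if "e \<in> C" for e
    using that by (cases "0 < x e") auto
  then have "0 < (\<Sum>e\<in>C. x e)"
    using finite e by (intro sum_pos) auto
  then show ?thesis using sum0 by simp
qed

end

section \<open>The Gram matrix of the edges minus the all-ones matrix\<close>

definition meet_form :: "'v set \<Rightarrow> 'v set \<Rightarrow> real" where
  "meet_form e f = real (card (e \<inter> f)) - 1"

lemma meet_form_commute: "meet_form e f = meet_form f e"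
  by (simp add: meet_form_def Int_commute)

text \<open>The left side is the squared norm of N^T z. Consequently \<open>meet_form\<close> is
  nonnegative on weightings of total 0, and among these its null vectors are exactly the balanced
  ones.\<close>

lemma sum_degree_squares:
  fixes F :: "'v::finite set set"
  shows "(\<Sum>v\<in>UNIV. (\<Sum>e | e \<in> F \<and> v \<in> e. z e)\<^sup>2)
    = (\<Sum>e\<in>F. \<Sum>f\<in>F. meet_form e f * (z e * z f)) + (\<Sum>e\<in>F. z e)\<^sup>2"
proof -
  have card: "real (card (e \<inter> f)) = (\<Sum>v\<in>UNIV. if v \<in> e \<and> v \<in> f then 1 else 0)" for e f :: "'v set"
    by (simp add: sum.If_cases Int_def)
  have "(\<Sum>v\<in>UNIV. (\<Sum>e | e \<in> F \<and> v \<in> e. z e)\<^sup>2)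
      = (\<Sum>v\<in>UNIV. (\<Sum>e\<in>F. if v \<in> e then z e else 0)\<^sup>2)"
    by (simp add: sum.If_cases Int_def)
  also have "\<dots> = (\<Sum>v\<in>UNIV. \<Sum>e\<in>F. \<Sum>f\<in>F. if v \<in> e \<and> v \<in> f then z e * z f else 0)"
    unfolding power2_eq_square sum_product by (intro sum.cong refl) auto
  also have "\<dots> = (\<Sum>e\<in>F. \<Sum>f\<in>F. \<Sum>v\<in>UNIV. if v \<in> e \<and> v \<in> f then z e * z f else 0)"
    by (subst sum.swap) (intro sum.cong refl sum.swap)
  also have "\<dots> = (\<Sum>e\<in>F. \<Sum>f\<in>F. real (card (e \<inter> f)) * (z e * z f))"
    unfolding card sum_distrib_right by (intro sum.cong refl) auto
  also have "\<dots> = (\<Sum>e\<in>F. \<Sum>f\<in>F. meet_form e f * (z e * z f) + z e * z f)"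
    by (intro sum.cong refl) (simp add: meet_form_def algebra_simps)
  also have "\<dots> = (\<Sum>e\<in>F. \<Sum>f\<in>F. meet_form e f * (z e * z f)) + (\<Sum>e\<in>F. z e)\<^sup>2"
    by (simp add: sum.distrib power2_eq_square sum_product)
  finally show ?thesis .
qed

text \<open>Here e may be any vertex set. An edge gives an entry of N N^T x; the set
  \<open>UNIV\<close>, which contains all s points of each edge of a uniform hypergraph, gives s
  times the total weight.\<close>

lemma balanced_sum_card:
  fixes F :: "'v::finite set set"
  assumes "balanced F x"
  shows "(\<Sum>f\<in>F. real (card (e \<inter> f)) * x f) = 0"
proof -
  have "(\<Sum>f\<in>F. real (card (e \<inter> f)) * x f) = (\<Sum>f\<in>F. \<Sum>v\<in>e. if v \<in> f then x f else 0)"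
    by (intro sum.cong refl) (simp add: sum.If_cases Int_def)
  also have "\<dots> = (\<Sum>v\<in>e. \<Sum>f | f \<in> F \<and> v \<in> f. x f)"
    by (subst sum.swap) (simp add: sum.If_cases Int_def)
  also have "\<dots> = 0"
    using assms by (simp add: balanced_def)
  finally show ?thesis .
qed

lemma balanced_sum:
  fixes F :: "'v::finite set set"
  assumes "balanced F x" "uniform s F" "0 < s"
  shows "(\<Sum>f\<in>F. x f) = 0"
proof -
  have "(\<Sum>f\<in>F. real s * x f) = (\<Sum>f\<in>F. real (card (UNIV \<inter> f)) * x f)"
    using assms(2) by (intro sum.cong) (auto simp: uniform_def)
  then show ?thesis
    using balanced_sum_card[OF assms(1), of UNIV] assms(3) by (simp add: sum_distrib_left[symmetric])
qed

lemma balanced_meet_form: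
  fixes F :: "'v::finite set set"
  assumes "balanced F x" "uniform s F" "0 < s"
  shows "(\<Sum>f\<in>F. meet_form e f * x f) = 0"
  using balanced_sum_card[OF assms(1), of e] balanced_sum[OF assms]
  by (simp add: meet_form_def left_diff_distrib sum_subtractf)

lemma symp_disjnt: "symp disjnt"
  by (simp add: symp_def disjnt_sym)

lemma symp_line_adj: "symp line_adj"
  by (auto simp: symp_def line_adj_def)

lemma linear_uniform_meet:
  assumes "linear_hypergraph F" "uniform s F" "e \<in> F" "f \<in> F" "e \<noteq> f" "\<not> disjnt e f"
  shows "card (e \<inter> f) = 1"
proof -
  have "finite (e \<inter> f)" "e \<inter> f \<noteq> {}"
    using assms by (auto simp: uniform_def disjnt_def)
  then have "card (e \<inter> f) \<noteq> 0" by simp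
  then show ?thesis
    using assms unfolding linear_hypergraph_def by (metis le_antisym less_one linorder_not_less)
qed

lemma meet_form_co_components:
  assumes "linear_hypergraph F" "uniform s F"
    and "C \<in> rel_components F disjnt" "D \<in> rel_components F disjnt" "C \<noteq> D" "e \<in> C" "f \<in> D"
  shows "card (e \<inter> f) = 1" "meet_form e f = 0"
proof -
  have "\<not> disjnt e f"
    using rel_components_separated[OF symp_disjnt assms(3-7)] .
  moreover have "e \<noteq> f"
    using rel_components_disjoint[OF symp_disjnt assms(3-5)] assms(6,7) by blast
  ultimately show "card (e \<inter> f) = 1"
    using linear_uniform_meet assms rel_component_subset by (metis subsetD)
  then show "meet_form e f = 0"
    by (simp add: meet_form_def)
qed

section \<open>Nets and co-components\<close>

lemma uniform_mono: "uniform s F \<Longrightarrow> G \<subseteq> F \<Longrightarrow> uniform s G"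
  by (auto simp: uniform_def)

lemma linear_hypergraph_mono: "linear_hypergraph F \<Longrightarrow> G \<subseteq> F \<Longrightarrow> linear_hypergraph G"
  by (auto simp: linear_hypergraph_def)

lemma net_line_through:
  assumes "net s a P \<C>" "c \<in> \<C>" "p \<in> P"
  obtains l where "l \<in> c" "p \<in> l"
  using assms by (auto simp: net_def partition_on_def)

lemma net_line_unique:
  assumes "net s a P \<C>" "c \<in> \<C>" "l \<in> c" "m \<in> c" "p \<in> l" "p \<in> m"
  shows "l = m"
proof -
  have "disjoint c"
    using assms(1,2) by (auto simp: net_def dest: partition_onD2)
  then show ?thesis
    using assms(3-6) by (auto simp: disjoint_def)
qed

lemma net_line_subset:
  assumes "net s a P \<C>" "l \<in> \<Union>\<C>"
  shows "l \<subseteq> P" "card l = s" "finite l"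
  using assms by (auto simp: net_def partition_on_def uniform_def)

lemma net_lines_meet:
  assumes "net s a P \<C>" "c \<in> \<C>" "d \<in> \<C>" "c \<noteq> d" "l \<in> c" "m \<in> d"
  shows "card (l \<inter> m) = 1"
  using assms unfolding net_def by blast

lemma net_finite_classes:
  assumes "net s a P \<C>"
  shows "finite \<C>"
proof (rule finite_subset)
  show "\<C> \<subseteq> Pow (Pow P)"
    using assms by (auto simp: net_def partition_on_def)
  show "finite (Pow (Pow P))"
    using assms by (simp add: net_def)
qed

lemma net_class_finite:
  assumes "net s a P \<C>" "c \<in> \<C>"
  shows "finite c"
  using assms finite_elements[of P c] by (simp add: net_def)

text \<open>A line in both classes would have to meet itself in exactly one point, but it has s
  points.\<close>

lemma net_classes_disjoint:
  assumes "net s a P \<C>" "s \<noteq> 1" "c \<in> \<C>" "d \<in> \<C>" "c \<noteq> d"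
  shows "c \<inter> d = {}"
proof (rule ccontr)
  assume "c \<inter> d \<noteq> {}"
  then obtain l where l: "l \<in> c" "l \<in> d" by blast
  have "card l = s"
    by (rule net_line_subset(2)[OF assms(1)]) (use l assms(3) in blast)
  then show False
    using net_lines_meet[OF assms(1,3-5) l] assms(2) by simp
qed

text \<open>Each class has one line through p, and lines of different classes share only p. Compared
  with the s^2 - 1 = (s + 1)(s - 1) other points, this count bounds the number of classes of a net,
  and in a plane it shows that p is joined to every other point.\<close>

lemma net_points_joined:
  assumes net: "net s a P \<C>" and p: "p \<in> P" and s: "2 \<le> s"
  shows "card (\<Union>l\<in>{l \<in> \<Union>\<C>. p \<in> l}. l - {p}) = a * (s - 1)"
proof -
  have "\<exists>l. l \<in> c \<and> p \<in> l" if "c \<in> \<C>" for c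
    using net_line_through[OF net that p] by blast
  then obtain L where L: "\<And>c. c \<in> \<C> \<Longrightarrow> L c \<in> c \<and> p \<in> L c"
    by metis
  have eq: "{l \<in> \<Union>\<C>. p \<in> l} = L ` \<C>"
    using L net_line_unique[OF net] by blast
  have fin: "finite (L c)" if "c \<in> \<C>" for c
    by (rule net_line_subset(3)[OF net]) (use L that in blast)
  have card: "card (L c - {p}) = s - 1" if "c \<in> \<C>" for c
    using L[OF that] net_line_subset[OF net, of "L c"] that by auto
  have disj: "(L c - {p}) \<inter> (L d - {p}) = {}" if "c \<in> \<C>" "d \<in> \<C>" "c \<noteq> d" for c d
  proof -
    have "card (L c \<inter> L d) = 1"
      using net_lines_meet[OF net that] L that by blast
    then obtain q where "L c \<inter> L d = {q}"
      by (auto simp: card_1_singleton_iff)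
    moreover have "p \<in> L c \<inter> L d"
      using L that by blast
    ultimately have "L c \<inter> L d = {p}" by simp
    then show ?thesis by blast
  qed
  have "card (\<Union>c\<in>\<C>. L c - {p}) = (\<Sum>c\<in>\<C>. card (L c - {p}))"
    by (rule card_UN_disjoint) (use net_finite_classes[OF net] disj fin in auto)
  also have "\<dots> = a * (s - 1)"
    using card net by (simp add: net_def)
  finally show ?thesis
    unfolding eq by simp
qed

lemma net_points_joined_subset:
  assumes "net s a P \<C>" "p \<in> P"
  shows "(\<Union>l\<in>{l \<in> \<Union>\<C>. p \<in> l}. l - {p}) \<subseteq> P - {p}"
  using net_line_subset(1)[OF assms(1)] by blast

lemma net_card_le:
  assumes net: "net s a P \<C>" and s: "2 \<le> s"
  shows "a \<le> s + 1"
proof -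
  have P: "finite P" "card P = s\<^sup>2"
    using net by (auto simp: net_def)
  then have "P \<noteq> {}"
    using s by auto
  then obtain p where p: "p \<in> P" by blast
  have "a * (s - 1) \<le> card (P - {p})"
    using card_mono[OF _ net_points_joined_subset[OF net p]] net_points_joined[OF net p s] P by simp
  also have "\<dots> = (s + 1) * (s - 1)"
    using P p by (simp add: power2_eq_square algebra_simps)
  finally show ?thesis
    unfolding mult_le_cancel2 using s by simp
qed

lemma plane_line_through_two_points:
  assumes net: "net s (s + 1) P \<C>" and s: "2 \<le> s" and pq: "p \<in> P" "q \<in> P" "p \<noteq> q"
  obtains l where "l \<in> \<Union>\<C>" "p \<in> l" "q \<in> l"
proof -
  have P: "finite P" "card P = s\<^sup>2"
    using net by (auto simp: net_def)
  have "card (P - {p}) = (s + 1) * (s - 1)"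
    using P pq by (simp add: power2_eq_square algebra_simps)
  then have eq: "(\<Union>l\<in>{l \<in> \<Union>\<C>. p \<in> l}. l - {p}) = P - {p}"
    using card_subset_eq[OF _ net_points_joined_subset[OF net pq(1)]]
      net_points_joined[OF net pq(1) s] P by simp
  have "q \<in> (\<Union>l\<in>{l \<in> \<Union>\<C>. p \<in> l}. l - {p})"
    unfolding eq using pq by blast
  then show ?thesis using that by blast
qed

section \<open>Blocks of the form on co-components\<close>

lemma co_component_ker:
  fixes F :: "'v::finite set set"
  assumes "uniform s F" "linear_hypergraph F" "0 < s" "balanced F x"
    and C: "C \<in> rel_components F disjnt" "e \<in> C"
  shows "(\<Sum>f\<in>C. meet_form e f * x f) = 0"
proof -
  have part: "partition_on F (rel_components F disjnt)"
    by (rule partition_on_rel_components[OF symp_disjnt])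
  have "(\<Sum>f\<in>C. meet_form e f * x f) = (\<Sum>f\<in>F. meet_form e f * x f)"
  proof (rule sum.mono_neutral_left)
    show "C \<subseteq> F" by (rule rel_component_subset[OF C(1)])
    show "\<forall>f\<in>F - C. meet_form e f * x f = 0"
    proof
      fix f assume f: "f \<in> F - C"
      then obtain D where "D \<in> rel_components F disjnt" "f \<in> D"
        using partition_onD1[OF part] by blast
      then show "meet_form e f * x f = 0"
        using meet_form_co_components(2)[OF assms(2,1) C(1) _ _ C(2)] f by auto
    qed
  qed simp
  then show ?thesis
    using balanced_meet_form[OF assms(4,1,3)] by simp
qed

text \<open>Given z on C, put S z on C and -\<sigma> x on D, where S is the sum of x over D and
  \<sigma> that of z over C. The total weight is 0, so the form is nonnegative by
  \<open>sum_degree_squares\<close>. Cross terms vanish, and so does the part on D because x is in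
  the kernel there; what remains is S^2 times the form at z.\<close>

lemma co_component_psd:
  fixes F :: "'v::finite set set"
  assumes F: "uniform s F" "linear_hypergraph F" "0 < s" "balanced F x"
    and C: "C \<in> rel_components F disjnt"
    and D: "D \<in> rel_components F disjnt" "C \<noteq> D" "(\<Sum>e\<in>D. x e) \<noteq> 0"
  shows "0 \<le> (\<Sum>e\<in>C. \<Sum>f\<in>C. meet_form e f * (z e * z f))"
proof -
  define S where "S = (\<Sum>e\<in>D. x e)"
  define \<sigma> where "\<sigma> = (\<Sum>e\<in>C. z e)"
  define w where "w e = (if e \<in> C then S * z e else - (\<sigma> * x e))" for e
  have disj: "C \<inter> D = {}"
    using rel_components_disjoint[OF symp_disjnt C D(1,2)] .
  have wD: "w e = - (\<sigma> * x e)" if "e \<in> D" for e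
    using that disj by (auto simp: w_def)
  have wC: "w e = S * z e" if "e \<in> C" for e
    using that by (simp add: w_def)
  have cross: "meet_form e f = 0" "meet_form f e = 0" if "e \<in> C" "f \<in> D" for e f
    using meet_form_co_components(2)[OF F(2,1) C D(1,2) that] by (simp_all add: meet_form_commute)
  have un: "(\<Sum>e\<in>C \<union> D. g e) = (\<Sum>e\<in>C. g e) + (\<Sum>e\<in>D. g e)" for g :: "'v set \<Rightarrow> real"
    using disj by (intro sum.union_disjoint) auto
  have "(\<Sum>e\<in>C \<union> D. w e) = S * \<sigma> - \<sigma> * S"
    unfolding un by (simp add: wC wD sum_distrib_left[symmetric] sum_negf S_def \<sigma>_def)
  then have "0 \<le> (\<Sum>e\<in>C \<union> D. \<Sum>f\<in>C \<union> D. meet_form e f * (w e * w f))"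
    using sum_degree_squares[of w "C \<union> D"] sum_nonneg[of UNIV "\<lambda>v. (\<Sum>e | e \<in> C \<union> D \<and> v \<in> e. w e)\<^sup>2"]
    by simp
  also have "\<dots> = (\<Sum>e\<in>C. \<Sum>f\<in>C. meet_form e f * (w e * w f))
      + (\<Sum>e\<in>D. \<Sum>f\<in>D. meet_form e f * (w e * w f))"
    unfolding un by (simp add: cross)
  also have "(\<Sum>e\<in>D. \<Sum>f\<in>D. meet_form e f * (w e * w f))
      = (\<Sum>e\<in>D. \<sigma>\<^sup>2 * x e * (\<Sum>f\<in>D. meet_form e f * x f))"
    unfolding sum_distrib_left
    by (intro sum.cong refl) (simp add: wD power2_eq_square algebra_simps)
  also have "\<dots> = 0"
    using co_component_ker[OF F D(1)] by simp
  also have "(\<Sum>e\<in>C. \<Sum>f\<in>C. meet_form e f * (w e * w f))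
      = S\<^sup>2 * (\<Sum>e\<in>C. \<Sum>f\<in>C. meet_form e f * (z e * z f))"
    unfolding sum_distrib_left
    by (intro sum.cong refl) (simp add: wC power2_eq_square algebra_simps)
  finally show ?thesis
    using D(3) by (simp add: S_def zero_le_mult_iff)
qed

lemma meet_form_disjnt: "disjnt e f \<Longrightarrow> meet_form e f < 0"
  by (simp add: meet_form_def disjnt_def)

lemma meet_form_nonpos:
  assumes "linear_hypergraph F" "e \<in> F" "f \<in> F" "e \<noteq> f"
  shows "meet_form e f \<le> 0"
  using assms by (auto simp: meet_form_def linear_hypergraph_def)

text \<open>The column of f in the block sums to s - |C| + t f, where t f >= 0 counts the points
  that f shares with other edges, with multiplicity. Pairing the column sums with the strictly
  positive kernel vector |x| gives 0. This is impossible for |C| < s, and for |C| = s it forces all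
  t f to vanish.\<close>

lemma co_component_card:
  fixes C :: "'v::finite set set"
  assumes C: "uniform s C" "linear_hypergraph C" "cut_connected C disjnt"
    and psd: "\<And>z. 0 \<le> (\<Sum>e\<in>C. \<Sum>f\<in>C. meet_form e f * (z e * z f))"
    and ker: "\<And>e. e \<in> C \<Longrightarrow> (\<Sum>f\<in>C. meet_form e f * x f) = 0"
    and e: "e \<in> C" "x e \<noteq> 0"
  shows "s \<le> card C" "card C = s \<Longrightarrow> pairwise disjnt C"
proof -
  have pos: "0 < \<bar>x f\<bar>" if "f \<in> C" for f
    using perron_zero_if_zero_entry[of C disjnt meet_form x f e, OF _ C(3) meet_form_disjnt
        meet_form_nonpos[OF C(2)] meet_form_commute psd ker that _ e(1)] e(2)
    by auto
  have kerabs: "(\<Sum>f\<in>C. meet_form e f * \<bar>x f\<bar>) = 0" if "e \<in> C" for e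
    using perron_abs_ker[of C disjnt meet_form x e, OF _ C(3) meet_form_disjnt
        meet_form_nonpos[OF C(2)] meet_form_commute psd ker that]
    by auto
  define t where "t f = (\<Sum>e\<in>C - {f}. real (card (e \<inter> f)))" for f :: "'v set"
  have col: "(\<Sum>e\<in>C. meet_form e f) = real s - real (card C) + t f" if "f \<in> C" for f
  proof -
    have "(\<Sum>e\<in>C. real (card (e \<inter> f))) = real s + t f"
      using that C(1) by (simp add: sum.remove t_def uniform_def)
    then show ?thesis
      by (simp add: meet_form_def sum_subtractf)
  qed
  have t0: "0 \<le> t f" for f
    unfolding t_def by (intro sum_nonneg) simp
  have "0 = (\<Sum>e\<in>C. \<Sum>f\<in>C. meet_form e f * \<bar>x f\<bar>)"
    using kerabs by simp
  also have "\<dots> = (\<Sum>f\<in>C. (\<Sum>e\<in>C. meet_form e f) * \<bar>x f\<bar>)"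
    by (subst sum.swap) (simp add: sum_distrib_right)
  also have "\<dots> = (\<Sum>f\<in>C. (real s - real (card C) + t f) * \<bar>x f\<bar>)"
    using col by simp
  finally have eq: "(\<Sum>f\<in>C. (real s - real (card C) + t f) * \<bar>x f\<bar>) = 0" by simp
  show "s \<le> card C"
  proof (rule ccontr)
    assume "\<not> s \<le> card C"
    then have "0 < real s - real (card C) + t f" for f
      using t0[of f] by linarith
    then have "0 < (\<Sum>f\<in>C. (real s - real (card C) + t f) * \<bar>x f\<bar>)"
      using pos e(1) by (intro sum_pos) auto
    then show False using eq by simp
  qed
  show "pairwise disjnt C" if "card C = s"
  proof (rule pairwiseI)
    fix e f assume ef: "e \<in> C" "f \<in> C" "e \<noteq> f"
    have "(\<Sum>f\<in>C. t f * \<bar>x f\<bar>) = 0"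
      using eq that by simp
    then have "t f * \<bar>x f\<bar> = 0"
      using t0 ef(2) by (subst (asm) sum_nonneg_eq_0_iff) auto
    then have "t f = 0"
      using pos[OF ef(2)] by simp
    then have "card (e \<inter> f) = 0"
      unfolding t_def using ef by (subst (asm) sum_nonneg_eq_0_iff) auto
    then show "disjnt e f"
      by (simp add: disjnt_def)
  qed
qed

text \<open>The witness \<open>\<S>\<close> consists of the co-components that support some balanced weighting.\<close>

definition special_classes :: "nat \<Rightarrow> 'v::finite set set \<Rightarrow> 'v set set set \<Rightarrow> bool" where
  "special_classes s F \<S> \<longleftrightarrow> \<S> \<subseteq> rel_components F disjnt \<and>
     (\<forall>C\<in>\<S>. s \<le> card C \<and> (card C = s \<longrightarrow> pairwise disjnt C)) \<and>
     card F + 1 \<le> incidence_rank F + card \<S>"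

text \<open>A balanced weighting is determined by its block sums, which add up to 0, so the kernel
  has dimension at most \<open>card \<S>\<close> - 1. Concretely, deleting one edge from each
  supporting block except C0 leaves independent rows.\<close>

lemma special_classes_exist:
  fixes F :: "'v::finite set set"
  assumes F: "uniform s F" "linear_hypergraph F" "0 < s"
    and x0: "balanced F x0" "C0 \<in> rel_components F disjnt" "(\<Sum>e\<in>C0. x0 e) \<noteq> 0"
  shows "\<exists>\<S>. special_classes s F \<S>"
proof -
  let ?co = "rel_components F disjnt"
  have part: "partition_on F ?co"
    by (rule partition_on_rel_components[OF symp_disjnt])
  have sum_co: "(\<Sum>C\<in>?co. \<Sum>e\<in>C. x e) = (\<Sum>e\<in>F. x e)" for x :: "'v set \<Rightarrow> real"
    using sum.Union_disjoint[of ?co x] part partition_onD1[OF part]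
    by (auto simp: partition_on_def disjoint_def)
  \<comment> \<open>\<open>co_component_psd\<close> handles every block other than the one with
    nonzero sum. A second such block, which exists since the total is 0, is needed to handle C0
    itself.\<close>
  have "\<exists>C1\<in>?co. C1 \<noteq> C0 \<and> (\<Sum>e\<in>C1. x0 e) \<noteq> 0"
  proof (rule ccontr)
    assume "\<not> ?thesis"
    then have "(\<Sum>e\<in>C. x0 e) = 0" if "C \<in> ?co - {C0}" for C
      using that by blast
    then have "(\<Sum>C\<in>?co. \<Sum>e\<in>C. x0 e) = (\<Sum>e\<in>C0. x0 e)"
      using x0(2) by (simp add: sum.remove)
    then show False
      using sum_co balanced_sum[OF x0(1) F(1,3)] x0(3) by simp
  qed
  then obtain C1 where C1: "C1 \<in> ?co" "C1 \<noteq> C0" "(\<Sum>e\<in>C1. x0 e) \<noteq> 0"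
    by blast
  have psd: "0 \<le> (\<Sum>e\<in>C. \<Sum>f\<in>C. meet_form e f * (z e * z f))" if "C \<in> ?co" for C z
  proof (cases "C = C0")
    case True
    then show ?thesis
      using co_component_psd[OF F x0(1) that C1(1) _ C1(3)] C1(2) by blast
  next
    case False
    then show ?thesis
      using co_component_psd[OF F x0(1) that x0(2) _ x0(3)] by blast
  qed
  have conn: "cut_connected C disjnt" if "C \<in> ?co" for C
    by (rule cut_connected_rel_component[OF symp_disjnt that])
  have lin: "linear_hypergraph C" "uniform s C" if "C \<in> ?co" for C
    using rel_component_subset[OF that] F linear_hypergraph_mono uniform_mono by blast+
  define \<S> where "\<S> = {C \<in> ?co. \<exists>x. balanced F x \<and> (\<exists>e\<in>C. x e \<noteq> 0)}"
  have C0: "C0 \<in> \<S>"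
    using x0 by (auto simp: \<S>_def intro: sum.neutral)
  have card: "s \<le> card C \<and> (card C = s \<longrightarrow> pairwise disjnt C)" if "C \<in> \<S>" for C
  proof -
    obtain x e where x: "C \<in> ?co" "balanced F x" "e \<in> C" "x e \<noteq> 0"
      using \<open>C \<in> \<S>\<close> by (auto simp: \<S>_def)
    show ?thesis
      using co_component_card[OF lin(2,1)[OF x(1)] conn[OF x(1)] psd[OF x(1)]
          co_component_ker[OF F x(2,1)] x(3,4)]
      by blast
  qed
  have "\<exists>e. e \<in> C" if "C \<in> \<S>" for C
    using that by (auto simp: \<S>_def)
  then obtain r where r: "\<And>C. C \<in> \<S> \<Longrightarrow> r C \<in> C"
    by metis
  \<comment> \<open>No edge of C0 is deleted: once the weighting vanishes on all other blocks, its
    sum over C0 is 0, and \<open>perron_zero_if_sum_zero\<close> applies.\<close>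
  define T where "T = r ` (\<S> - {C0})"
  have sub: "\<S> \<subseteq> ?co"
    by (auto simp: \<S>_def)
  have "inj_on r \<S>"
  proof (rule inj_onI)
    fix C D assume "C \<in> \<S>" "D \<in> \<S>" "r C = r D"
    then show "C = D"
      using r[of C] r[of D] sub rel_components_disjoint[OF symp_disjnt, of C F D] by force
  qed
  then have cardT: "card T + 1 = card \<S>"
    using C0 card_Suc_Diff1[of \<S> C0] by (simp add: T_def card_image inj_on_diff)
  have TF: "T \<subseteq> F"
    using r sub rel_component_subset by (fastforce simp: T_def)
  have "row_independent (F - T)"
    unfolding row_independent_def
  proof (intro allI impI ballI)
    fix x e assume x: "balanced (F - T) x" and e: "e \<in> F - T"
    define y where "y f = (if f \<in> F - T then x f else 0)" for f
    have y: "balanced F y"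
      using balanced_extend[of "F - T" F x] x unfolding y_def by blast
    have off: "y f = 0" if "C \<in> ?co" "C \<noteq> C0" "f \<in> C" for C f
    proof (cases "C \<in> \<S>")
      case True
      then have "r C \<in> C" "y (r C) = 0"
        using r that(2) by (auto simp: y_def T_def)
      then show ?thesis
        using perron_zero_if_zero_entry[of C disjnt meet_form y "r C" f, OF _ conn[OF that(1)]
            meet_form_disjnt meet_form_nonpos[OF lin(1)[OF that(1)]] meet_form_commute
            psd[OF that(1)] co_component_ker[OF F y that(1)] _ _ that(3)]
        by simp
    next
      case False
      then show ?thesis
        using that y by (auto simp: \<S>_def)
    qed
    have "(\<Sum>C\<in>?co - {C0}. \<Sum>e\<in>C. y e) = 0"
      using off by (intro sum.neutral ballI) blast
    then have "(\<Sum>C\<in>?co. \<Sum>e\<in>C. y e) = (\<Sum>e\<in>C0. y e)"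
      using x0(2) by (simp add: sum.remove)
    then have "(\<Sum>e\<in>C0. y e) = 0"
      using sum_co balanced_sum[OF y F(1,3)] by simp
    then have "y f = 0" if "f \<in> C0" for f
      using perron_zero_if_sum_zero[of C0 disjnt meet_form y f, OF _ conn[OF x0(2)]
            meet_form_disjnt meet_form_nonpos[OF lin(1)[OF x0(2)]] meet_form_commute
            psd[OF x0(2)] co_component_ker[OF F y x0(2)] _ that]
      by simp
    then have "y e = 0"
      using off e partition_onD1[OF part] by blast
    then show "x e = 0"
      using e by (simp add: y_def)
  qed
  then have "card (F - T) \<le> incidence_rank F"
    by (rule card_row_independent_le_rank) blast
  then have "card F + 1 \<le> incidence_rank F + card \<S>"
    using TF cardT by (simp add: card_Diff_subset)
  then show ?thesis
    using sub card unfolding special_classes_def by blast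
qed

section \<open>Lower bounds for the defect\<close>

text \<open>All edges of F through a vertex of P belong to P, so the vertex sums in P and in F agree
  there.\<close>

lemma balanced_component:
  assumes "balanced F x" "P \<in> rel_components F line_adj"
  shows "balanced P x"
  unfolding balanced_def
proof
  fix v
  show "(\<Sum>e | e \<in> P \<and> v \<in> e. x e) = 0"
  proof (cases "\<exists>e\<in>P. v \<in> e")
    case True
    then obtain e where e: "e \<in> P" "v \<in> e" by blast
    have "f \<in> P" if f: "f \<in> F" "v \<in> f" for f
    proof (rule ccontr)
      assume "f \<notin> P"
      moreover obtain Q where "Q \<in> rel_components F line_adj" "f \<in> Q"
        using rel_component_exists[OF f(1)] .
      ultimately have "\<not> line_adj e f"
        using rel_components_separated[OF symp_line_adj assms(2)] e(1) by blast
      then show False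
        using e f \<open>f \<notin> P\<close> by (auto simp: line_adj_def)
    qed
    then have "{e. e \<in> P \<and> v \<in> e} = {e. e \<in> F \<and> v \<in> e}"
      using rel_component_subset[OF assms(2)] by blast
    then show ?thesis
      using assms(1) by (simp add: balanced_def)
  next
    case False
    then have "{e. e \<in> P \<and> v \<in> e} = {}" by blast
    then show ?thesis by (simp only: sum.empty)
  qed
qed

lemma rank_defect_components:
  fixes F :: "'v::finite set set"
  shows "(\<Sum>P\<in>rel_components F line_adj. rank_defect s P) \<le> rank_defect s F"
  by (rule rank_defect_superadditive[OF partition_on_rel_components[OF symp_line_adj]
        balanced_component])

text \<open>The form of the block vanishes at x because x is in its kernel. With block sum 0,
  \<open>sum_degree_squares\<close> says that the squares of the vertex sums over C add up to
  0.\<close>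

lemma balanced_co_component:
  fixes F :: "'v::finite set set"
  assumes F: "uniform s F" "linear_hypergraph F" "0 < s" "balanced F x"
    and C: "C \<in> rel_components F disjnt" "(\<Sum>e\<in>C. x e) = 0"
  shows "balanced C x"
proof -
  have "(\<Sum>e\<in>C. \<Sum>f\<in>C. meet_form e f * (x e * x f)) = (\<Sum>e\<in>C. x e * (\<Sum>f\<in>C. meet_form e f * x f))"
    unfolding sum_distrib_left by (intro sum.cong refl) simp
  also have "\<dots> = 0"
    using co_component_ker[OF F C(1)] by simp
  finally have "(\<Sum>v\<in>UNIV. (\<Sum>e | e \<in> C \<and> v \<in> e. x e)\<^sup>2) = 0"
    using sum_degree_squares[of x C] C(2) by simp
  then show ?thesis
    by (subst (asm) sum_nonneg_eq_0_iff) (auto simp: balanced_def)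
qed

text \<open>The disjoint sets of K pick out pairwise different points of e, as many as e
  has.\<close>

lemma transversal_subset:
  assumes "finite K" "finite e" "card K = card e"
    and "\<And>k. k \<in> K \<Longrightarrow> card (k \<inter> e) = 1" "pairwise disjnt K"
  shows "e \<subseteq> \<Union>K"
proof -
  have "card (\<Union>k\<in>K. k \<inter> e) = (\<Sum>k\<in>K. card (k \<inter> e))"
    using assms by (intro card_UN_disjoint) (auto simp: pairwise_def disjnt_def)
  also have "\<dots> = card e"
    using assms(3,4) by simp
  finally have "(\<Union>k\<in>K. k \<inter> e) = e"
    using assms(2) by (intro card_subset_eq) auto
  then show ?thesis by blast
qed

text \<open>An edge outside K meets each of the s disjoint edges of K in one point, hence is covered
  by them. All blocks of this kind therefore have the same point set.\<close>

lemma co_component_points: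
  fixes F :: "'v::finite set set"
  assumes F: "uniform s F" "linear_hypergraph F"
    and K: "K \<in> rel_components F disjnt" "card K = s" "pairwise disjnt K"
  shows "\<Union>K = \<Union>F" "card (\<Union>K) = s\<^sup>2"
proof -
  have KF: "K \<subseteq> F" by (rule rel_component_subset[OF K(1)])
  have "f \<subseteq> \<Union>K" if f: "f \<in> F" for f
  proof -
    obtain D where D: "D \<in> rel_components F disjnt" "f \<in> D"
      using rel_component_exists[OF f] .
    show ?thesis
    proof (cases "K = D")
      case False
      then show ?thesis
        using meet_form_co_components(1)[OF F(2,1) K(1) D(1) _ _ D(2)] F(1) f K
        by (intro transversal_subset) (auto simp: uniform_def)
    qed (use D in blast)
  qed
  then show "\<Union>K = \<Union>F"
    using KF by blast
  have "card (\<Union>K) = sum card K"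
    using K(3) by (intro card_Union_disjoint) (auto simp: pairwise_def)
  also have "\<dots> = s\<^sup>2"
    using KF F(1) K(2) by (simp add: uniform_def power2_eq_square subset_eq)
  finally show "card (\<Union>K) = s\<^sup>2" .
qed

lemma special_net:
  fixes F :: "'v::finite set set"
  assumes F: "uniform s F" "linear_hypergraph F" "0 < s"
    and \<S>: "\<S> \<subseteq> rel_components F disjnt" "\<And>C. C \<in> \<S> \<Longrightarrow> card C = s \<and> pairwise disjnt C"
    and ne: "\<S> \<noteq> {}"
  shows "net s (card \<S>) (\<Union>F) \<S>"
proof -
  obtain K where "K \<in> \<S>" using ne by blast
  then have "card (\<Union>F) = s\<^sup>2"
    using co_component_points[OF F(1,2), of K] \<S> by auto
  moreover have sub: "\<Union>\<S> \<subseteq> F"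
    using \<S>(1) rel_component_subset by blast
  moreover have "partition_on (\<Union>F) C" if "C \<in> \<S>" for C
  proof (rule partition_onI)
    show "\<Union>C = \<Union>F"
      using co_component_points(1)[OF F(1,2), of C] \<S> that by blast
    show "disjnt p q" if "p \<in> C" "q \<in> C" "p \<noteq> q" for p q
      using \<S>(2)[OF \<open>C \<in> \<S>\<close>] that by (auto simp: pairwise_def)
    show "{} \<notin> C"
      using F(1,3) sub that by (fastforce simp: uniform_def)
  qed
  moreover have "card (l \<inter> m) = 1" if "C \<in> \<S>" "D \<in> \<S>" "C \<noteq> D" "l \<in> C" "m \<in> D" for C D l m
    using meet_form_co_components(1)[OF F(2,1), of C D l m] \<S>(1) that by blast
  ultimately show ?thesis
    using \<S>(2) uniform_mono[OF F(1)] linear_hypergraph_mono[OF F(2)]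
    unfolding net_def by auto
qed

text \<open>With k = \<open>card \<S>\<close> and a blocks of exactly s edges, |F| >= s k + (k - a),
  and the kernel has dimension at most k - 1. Hence the defect is at least s k + k - a - (s + 1)(k -
  1) = s + 1 - a.\<close>

lemma special_defect:
  fixes F :: "'v::finite set set"
  assumes "special_classes s F \<S>"
  shows "int s + 1 - int (card {C \<in> \<S>. card C = s}) \<le> rank_defect s F"
proof -
  define \<S>0 where "\<S>0 = {C \<in> \<S>. card C = s}"
  have sub: "\<S>0 \<subseteq> \<S>" by (auto simp: \<S>0_def)
  have sp: "\<S> \<subseteq> rel_components F disjnt" "\<And>C. C \<in> \<S> \<Longrightarrow> s \<le> card C"
    "card F + 1 \<le> incidence_rank F + card \<S>"
    using assms by (auto simp: special_classes_def)
  have "s * card \<S> + card (\<S> - \<S>0) = (\<Sum>C\<in>\<S>. s + (if C \<in> \<S>0 then 0 else 1))"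
    by (simp add: sum.distrib sum.If_cases set_diff_eq Int_def)
  also have "\<dots> \<le> (\<Sum>C\<in>\<S>. card C)"
  proof (rule sum_mono)
    fix C assume "C \<in> \<S>"
    then show "s + (if C \<in> \<S>0 then 0 else 1) \<le> card C"
      using sp(2)[of C] by (auto simp: \<S>0_def)
  qed
  also have "\<dots> \<le> (\<Sum>C\<in>rel_components F disjnt. card C)"
    using sp(1) by (intro sum_mono2) auto
  also have "\<dots> = card F"
    using card_partition_on[OF partition_on_rel_components[OF symp_disjnt], of F] by simp
  finally have "int s * int (card \<S>) + int (card \<S>) - int (card \<S>0) \<le> int (card F)"
    using card_Diff_subset[OF _ sub] card_mono[OF _ sub] by (simp add: of_nat_diff flip: of_nat_mult)
  moreover have "(int s + 1) * (int (card F) + 1 - int (card \<S>)) \<le> (int s + 1) * int (incidence_rank F)"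
    using sp(3) by (intro mult_left_mono) auto
  ultimately show ?thesis
    unfolding rank_defect_def \<S>0_def[symmetric] by (simp add: algebra_simps)
qed

lemma row_independent_one_uniform:
  assumes "uniform 1 F"
  shows "row_independent F"
  unfolding row_independent_def
proof (intro allI impI ballI)
  fix x e assume x: "balanced F x" and e: "e \<in> F"
  then obtain v where v: "e = {v}"
    using assms by (auto simp: uniform_def card_1_singleton_iff)
  have "{f. f \<in> F \<and> v \<in> f} = {e}"
    using assms e v by (fastforce simp: uniform_def card_1_singleton_iff)
  then show "x e = 0"
    using x unfolding balanced_def by (metis finite.emptyI sum.insert empty_iff sum.empty add_0_right)
qed

lemma row_independent_singleton:
  assumes "e \<noteq> {}"
  shows "row_independent {e}"
  unfolding row_independent_def
proof (intro allI impI ballI)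
  fix x f assume x: "balanced {e} x" and f: "f \<in> {e}"
  obtain v where "v \<in> e" using assms by blast
  then have "{g. g \<in> {e} \<and> v \<in> g} = {e}" by blast
  then have "sum x {e} = 0"
    using x unfolding balanced_def by metis
  then show "x f = 0"
    using f by simp
qed

lemma rank_defect_row_independent:
  fixes F :: "'v::finite set set"
  assumes "row_independent F"
  shows "rank_defect s F = int (card F)"
  using full_row_rank_if_row_independent[OF assms]
  by (simp add: rank_defect_def full_row_rank_def algebra_simps)

text \<open>The blocks of exactly s edges form a net, so there are at most s + 1 of them.\<close>

lemma special_defect_nonneg:
  fixes F :: "'v::finite set set"
  assumes F: "uniform s F" "linear_hypergraph F" "2 \<le> s" and sp: "special_classes s F \<S>"
  shows "0 \<le> rank_defect s F"
proof (cases "{C \<in> \<S>. card C = s} = {}")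
  case True
  then show ?thesis
    using special_defect[OF sp] by (simp only: card.empty)
next
  case False
  have "net s (card {C \<in> \<S>. card C = s}) (\<Union>F) {C \<in> \<S>. card C = s}"
    by (rule special_net[OF F(1,2) _ _ _ False]) (use sp F(3) in \<open>auto simp: special_classes_def\<close>)
  then have "card {C \<in> \<S>. card C = s} \<le> s + 1"
    by (rule net_card_le) (rule F(3))
  then show ?thesis
    using special_defect[OF sp] by linarith
qed

lemma line_adj_disjnt: "\<lbrakk>disjnt e f; e \<noteq> f\<rbrakk> \<Longrightarrow> \<not> line_adj e f"
  by (auto simp: line_adj_def disjnt_def)

text \<open>When every balanced weighting restricts to the components of the co-components, no such piece
  can contain \<open>s\<close> disjoint edges: an edge of another co-component would be covered by them and
  miss the other pieces.\<close>

lemma special_classes_or_large_defect: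
  fixes F :: "'v::finite set set"
  assumes "uniform s F" "linear_hypergraph F" "0 < s" "cograph F line_adj"
    and "cut_connected F line_adj" "\<not> row_independent F"
  shows "int s \<le> rank_defect s F \<or> (\<exists>\<S>. special_classes s F \<S>)"
  using assms
proof (induction "card F" arbitrary: F rule: less_induct)
  case less
  let ?co = "rel_components F disjnt"
  note F = less.prems(1-3)
  have s2: "2 \<le> s"
    using row_independent_one_uniform less.prems(1,3,6) by (cases "s = 1") auto
  have ne: "e \<noteq> {}" if "e \<in> F" for e
    using F that by (auto simp: uniform_def)
  have card2: "2 \<le> card G" if "\<not> row_independent G" "G \<subseteq> F" for G
  proof (rule ccontr)
    assume "\<not> 2 \<le> card G"
    then have "card G = 0 \<or> card G = 1" by linarith
    then consider "G = {}" | e where "G = {e}"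
      by (auto simp: card_1_singleton_iff)
    then show False
    proof cases
      case 1
      then show False
        using that(1) by (simp add: row_independent_def)
    next
      case 2
      then show False
        using that row_independent_singleton[OF ne] by simp
    qed
  qed
  have part: "partition_on F ?co"
    by (rule partition_on_rel_components[OF symp_disjnt])
  show ?case
  proof (cases "\<exists>x C. balanced F x \<and> C \<in> ?co \<and> (\<Sum>e\<in>C. x e) \<noteq> 0")
    case True
    then show ?thesis
      using special_classes_exist[OF F] by blast
  next
    case False
    then have restrict: "balanced C x" if "balanced F x" "C \<in> ?co" for x C
      using balanced_co_component[OF F that] that by blast
    \<comment> \<open>F is connected in the line graph, so it is disconnected under disjointness.
      Its co-components are proper subsets, and induction applies to their pieces.\<close>
    have not_co: "\<not> cut_connected F disjnt"
      using cograph_not_both_connected[OF _ symp_line_adj less.prems(4) card2[OF less.prems(6)]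
          less.prems(5), of disjnt] line_adj_disjnt by auto
    obtain x e where x: "balanced F x" "e \<in> F" "x e \<noteq> 0"
      using less.prems(6) by (auto simp: row_independent_def)
    obtain C where C: "C \<in> ?co" "e \<in> C"
      using rel_component_exists[OF x(2)] .
    have smaller: "D \<subseteq> F" "card D < card F" if "D \<in> ?co" for D
    proof -
      show "D \<subseteq> F" by (rule rel_component_subset[OF that])
      moreover have "D \<noteq> F"
        using cut_connected_rel_component[OF symp_disjnt that] not_co by blast
      ultimately show "card D < card F"
        by (intro psubset_card_mono) auto
    qed
    have piece: "uniform s P" "linear_hypergraph P" "cograph P line_adj" "cut_connected P line_adj"
      "P \<subseteq> D" "int s \<le> rank_defect s P \<or> row_independent P \<or> (\<exists>\<S>. special_classes s P \<S>)"
      if "D \<in> ?co" "P \<in> rel_components D line_adj" for D P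
    proof -
      show PD: "P \<subseteq> D" by (rule rel_component_subset[OF that(2)])
      have PF: "P \<subseteq> F" using PD smaller(1)[OF that(1)] by blast
      have "card P < card F"
        using card_mono[OF _ PD] smaller(2)[OF that(1)] by simp
      moreover show "uniform s P" "linear_hypergraph P" "cograph P line_adj"
        "cut_connected P line_adj"
        using uniform_mono[OF F(1) PF] linear_hypergraph_mono[OF F(2) PF]
          cograph_mono[OF less.prems(4) PF] cut_connected_rel_component[OF symp_line_adj that(2)]
        by blast+
      ultimately show "int s \<le> rank_defect s P \<or> row_independent P \<or> (\<exists>\<S>. special_classes s P \<S>)"
        using less.hyps[of P] F(3) by blast
    qed
    \<comment> \<open>Nonnegativity of every piece lets a single piece of defect at least s bound
      the sums from below.\<close>
    have nonneg: "0 \<le> rank_defect s P" if "D \<in> ?co" "P \<in> rel_components D line_adj" for D P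
      using piece(6)[OF that] rank_defect_row_independent[of P s]
        special_defect_nonneg[OF piece(1,2)[OF that] s2] by fastforce
    have sum_pieces: "(\<Sum>P\<in>rel_components D line_adj. rank_defect s P) \<le> rank_defect s D" for D :: "'v set set"
      by (rule rank_defect_components)
    have nonneg_co: "0 \<le> rank_defect s D" if "D \<in> ?co" for D
      using sum_pieces[of D] sum_nonneg[of _ "rank_defect s"] nonneg[OF that] by (meson order_trans)
    have Cx: "balanced C x" by (rule restrict[OF x(1) C(1)])
    then have "\<not> row_independent C"
      using x(3) C(2) by (auto simp: row_independent_def)
    then have cardC: "2 \<le> card C"
      using card2 smaller(1)[OF C(1)] by blast
    \<comment> \<open>The dual situation: C is connected under disjointness, so it splits in the
      line graph. This provides the piece Q different from P.\<close>
    have not_conn: "\<not> cut_connected C line_adj"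
      using cograph_not_both_connected[OF _ symp_line_adj cograph_mono[OF less.prems(4)
            smaller(1)[OF C(1)]] cardC, of disjnt] line_adj_disjnt
        cut_connected_rel_component[OF symp_disjnt C(1)] by auto
    obtain P where P: "P \<in> rel_components C line_adj" "e \<in> P"
      using rel_component_exists[OF C(2)] .
    have "\<not> row_independent P"
      using balanced_component[OF Cx P(1)] x(3) P(2) by (auto simp: row_independent_def)
    have "int s \<le> rank_defect s P"
    proof (rule ccontr)
      assume small: "\<not> int s \<le> rank_defect s P"
      then obtain \<S> where sp: "special_classes s P \<S>"
        using piece(6)[OF C(1) P(1)] \<open>\<not> row_independent P\<close> by blast
      \<comment> \<open>Otherwise \<open>special_defect\<close> with a = 0 gives defect at least s +
        1.\<close>
      have "{C \<in> \<S>. card C = s} \<noteq> {}"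
      proof
        assume "{C \<in> \<S>. card C = s} = {}"
        then show False
          using special_defect[OF sp] small by (simp only: card.empty)
      qed
      then obtain K where K: "K \<subseteq> P" "card K = s" "pairwise disjnt K"
        using sp rel_component_subset unfolding special_classes_def by blast
      obtain D where D: "D \<in> ?co" "D \<noteq> C"
        using rel_components_split[OF symp_disjnt not_co C(1)] .
      obtain g where g: "g \<in> D"
        using partition_onD3[OF part] D(1) by (metis all_not_in_conv)
      obtain Q where Q: "Q \<in> rel_components C line_adj" "Q \<noteq> P"
        using rel_components_split[OF symp_line_adj not_conn P(1)] .
      obtain f where f: "f \<in> Q"
        using partition_onD3[OF partition_on_rel_components[OF symp_line_adj, of C]] Q(1)
        by (metis all_not_in_conv)
      have PC: "P \<subseteq> C" and QC: "Q \<subseteq> C"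
        using piece(5)[OF C(1)] P(1) Q(1) by blast+
      have meet: "card (k \<inter> g) = 1" if "k \<in> C" for k
        using meet_form_co_components(1)[OF F(2,1) C(1) D(1) _ that g] D(2) by blast
      have "card g = s"
        using F(1) smaller(1)[OF D(1)] g by (auto simp: uniform_def)
      then have "g \<subseteq> \<Union>K"
        using K PC meet by (intro transversal_subset) auto
      moreover obtain v where "v \<in> f" "v \<in> g"
        using meet[of f] f QC by (auto simp: card_1_singleton_iff)
      ultimately obtain k where k: "k \<in> K" "v \<in> k" by blast
      have "k \<noteq> f"
        using rel_components_disjoint[OF symp_line_adj P(1) Q(1)] Q(2) k f K(1) by blast
      moreover have "\<not> line_adj k f"
        using rel_components_separated[OF symp_line_adj P(1) Q(1) _ _ f] Q(2) k(1) K(1) by blast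
      ultimately show False
        using k \<open>v \<in> f\<close> by (auto simp: line_adj_def)
    qed
    also have "rank_defect s P \<le> (\<Sum>P\<in>rel_components C line_adj. rank_defect s P)"
      using P(1) nonneg[OF C(1)] by (intro member_le_sum) auto
    also have "\<dots> \<le> rank_defect s C" by (rule sum_pieces)
    also have "\<dots> \<le> (\<Sum>D\<in>?co. rank_defect s D)"
      using C(1) nonneg_co by (intro member_le_sum) auto
    also have "\<dots> \<le> rank_defect s F"
      by (rule rank_defect_superadditive[OF part restrict])
    finally show ?thesis by blast
  qed
qed

section \<open>Completion to a plane\<close>

text \<open>\<open>Comp\<close> speaks about points in \<open>nat\<close>. A net is carried there by
  an injection, completed, and carried back by the inverse, which returns the original classes to
  themselves.\<close>

lemma net_image:
  assumes net: "net s a P \<C>" and inj: "inj_on f P"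
  shows "net s a (f ` P) ((`) ((`) f) ` \<C>)"
proof -
  have part: "partition_on P c" "card c = s" if "c \<in> \<C>" for c
    using net that by (auto simp: net_def)
  have classP: "c \<subseteq> Pow P" if "c \<in> \<C>" for c
    using part(1)[OF that] by (auto simp: partition_on_def)
  have lineP: "l \<subseteq> P" "card l = s" "finite l" if "l \<in> c" "c \<in> \<C>" for l c
    using net_line_subset[OF net, of l] that by auto
  have inj2: "inj_on ((`) f) (Pow P)"
    by (rule inj_on_image_Pow[OF inj])
  then have inj3: "inj_on ((`) ((`) f)) (Pow (Pow P))"
    by (rule inj_on_image_Pow)
  have int: "card (f ` l \<inter> f ` m) = card (l \<inter> m)" if "l \<in> c" "c \<in> \<C>" "m \<in> d" "d \<in> \<C>" for l m c d
  proof -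
    have "f ` l \<inter> f ` m = f ` (l \<inter> m)"
      using inj_on_image_Int[OF inj lineP(1)[OF that(1,2)] lineP(1)[OF that(3,4)]] by simp
    moreover have "inj_on f (l \<inter> m)"
      using inj_on_subset[OF inj] lineP(1)[OF that(1,2)] by blast
    ultimately show ?thesis
      by (simp add: card_image)
  qed
  have "card ((`) ((`) f) ` \<C>) = a"
    using card_image[OF inj_on_subset[OF inj3]] classP net by (auto simp: net_def)
  moreover have "uniform s (\<Union>((`) ((`) f) ` \<C>))"
    unfolding uniform_def using lineP card_image[OF inj_on_subset[OF inj]] by fastforce
  moreover have "linear_hypergraph (\<Union>((`) ((`) f) ` \<C>))"
  proof -
    have "card (f ` l \<inter> f ` m) \<le> 1" if "l \<in> c" "c \<in> \<C>" "m \<in> d" "d \<in> \<C>" "f ` l \<noteq> f ` m" for l m c d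
    proof -
      have "l \<noteq> m" using that(5) by blast
      then have "card (l \<inter> m) \<le> 1"
        using net that by (auto simp: net_def linear_hypergraph_def)
      then show ?thesis using int[OF that(1-4)] by simp
    qed
    then show ?thesis
      unfolding linear_hypergraph_def by blast
  qed
  moreover have "partition_on (f ` P) ((`) f ` c)" "card ((`) f ` c) = s" if "c \<in> \<C>" for c
  proof -
    have "{} \<notin> (`) f ` c"
      using partition_onD3[OF part(1)[OF that]] by auto
    then show "partition_on (f ` P) ((`) f ` c)"
      using partition_on_inj_image[OF part(1)[OF that] inj] by simp
    show "card ((`) f ` c) = s"
      using card_image[OF inj_on_subset[OF inj2 classP[OF that]]] part(2)[OF that] by simp
  qed
  moreover have "card (l \<inter> m) = 1"
    if "c \<in> (`) ((`) f) ` \<C>" "d \<in> (`) ((`) f) ` \<C>" "c \<noteq> d" "l \<in> c" "m \<in> d" for c d l m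
  proof -
    obtain c' d' l' m' where *: "c' \<in> \<C>" "c = (`) f ` c'" "d' \<in> \<C>" "d = (`) f ` d'"
      "l' \<in> c'" "l = f ` l'" "m' \<in> d'" "m = f ` m'"
      using \<open>c \<in> _\<close> \<open>d \<in> _\<close> \<open>l \<in> c\<close> \<open>m \<in> d\<close> by blast
    then have "c' \<noteq> d'" using \<open>c \<noteq> d\<close> by blast
    then show ?thesis
      using net_lines_meet[OF net *(1,3) _ *(5,7)] int[OF *(5,1,7,3)] * by simp
  qed
  ultimately show ?thesis
    using net card_image[OF inj] unfolding net_def by auto
qed

lemma Comp_extend:
  fixes P :: "'a set"
  assumes comp: "Comp s d" and net: "net s a P \<C>" and "deficiency s a \<le> int d"
  obtains \<D> where "net s (s + 1) P \<D>" "\<C> \<subseteq> \<D>"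
proof -
  have "finite P"
    using net by (simp add: net_def)
  then obtain f :: "'a \<Rightarrow> nat" where f: "inj_on f P"
    using finite_imp_inj_to_nat_seg by blast
  let ?g = "inv_into P f"
  let ?F = "(`) ((`) f)" and ?G = "(`) ((`) ?g)"
  obtain \<D> where \<D>: "net s (s + 1) (f ` P) \<D>" "?F ` \<C> \<subseteq> \<D>"
    using comp net_image[OF net f] assms(3) unfolding Comp_def by blast
  have g: "?g ` f ` l = l" if "l \<subseteq> P" for l
    using inv_into_image_cancel[OF f that] .
  have "?G (?F c) = c" if "c \<in> \<C>" for c
  proof -
    have "l \<subseteq> P" if "l \<in> c" for l
      using net_line_subset(1)[OF net] that \<open>c \<in> \<C>\<close> by blast
    then show ?thesis
      using g by (auto simp: image_iff)
  qed
  then have "\<C> = ?G ` ?F ` \<C>"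
    unfolding image_image[of ?G] by simp
  also have "\<dots> \<subseteq> ?G ` \<D>"
    by (rule image_mono[OF \<D>(2)])
  finally have "\<C> \<subseteq> ?G ` \<D>" .
  moreover have "net s (s + 1) P (?G ` \<D>)"
    using net_image[OF \<D>(1) inj_on_inv_into[OF subset_refl]] g by simp
  ultimately show ?thesis using that by blast
qed

lemma net_card_lines:
  assumes "net s a P \<C>" "s \<noteq> 1" "\<K> \<subseteq> \<C>"
  shows "card (\<Union>\<K>) = card \<K> * s" "finite (\<Union>\<K>)"
proof -
  have "card (\<Union>\<K>) = (\<Sum>c\<in>\<K>. card c)"
    using net_classes_disjoint[OF assms(1,2)] net_class_finite[OF assms(1)] assms(3)
    by (intro card_Union_disjoint) (auto simp: pairwise_def disjnt_def subset_eq)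
  also have "\<dots> = card \<K> * s"
    using assms(1,3) by (auto simp: net_def subset_eq)
  finally show "card (\<Union>\<K>) = card \<K> * s" .
  show "finite (\<Union>\<K>)"
    using net_class_finite[OF assms(1)] finite_subset[OF assms(3) net_finite_classes[OF assms(1)]]
      assms(3) by blast
qed

lemma net_disjnt_same_class:
  assumes "net s a P \<C>" "c \<in> \<C>" "d \<in> \<C>" "l \<in> c" "m \<in> d" "disjnt l m"
  shows "c = d"
  using net_lines_meet[OF assms(1-3) _ assms(4,5)] assms(6) by (auto simp: disjnt_def)

lemma net_points:
  assumes "net s a P \<C>" "\<C> \<noteq> {}"
  shows "\<Union>(\<Union>\<C>) = P"
proof -
  have "\<Union>c = P" if "c \<in> \<C>" for c
    using assms(1) that by (auto simp: net_def dest: partition_onD1)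
  then show ?thesis
    using assms(2) by blast
qed

lemma net_subset:
  assumes "net s a P \<C>" "\<K> \<subseteq> \<C>"
  shows "net s (card \<K>) P \<K>"
proof -
  have "\<Union>\<K> \<subseteq> \<Union>\<C>" using assms(2) by blast
  then have "uniform s (\<Union>\<K>)" "linear_hypergraph (\<Union>\<K>)"
    using uniform_mono[of s "\<Union>\<C>"] linear_hypergraph_mono[of "\<Union>\<C>"] assms(1)
    by (simp_all add: net_def)
  then show ?thesis
    using assms unfolding net_def by (meson subsetD)
qed

text \<open>Bruck's argument: a transversal \<open>e\<close> of \<open>\<S>\<close> that is not a line meets every line of the other
  \<open>h\<close> classes in at most \<open>h - 1\<close> points, because a point of \<open>e\<close> off the line is joined to
  those points within distinct classes. Counting \<open>e\<close> from one of its points then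
  gives \<open>s \<le> (h - 1)\<^sup>2\<close>.\<close>

lemma transversal_is_line:
  assumes net: "net s (s + 1) P \<L>" and s: "2 \<le> s"
    and \<S>: "\<S> \<subseteq> \<L>" "card \<S> + h = s + 1"
    and h: "h \<le> d" "int s > (int d - 1)\<^sup>2"
    and e: "e \<subseteq> P" "card e = s" "\<And>l. l \<in> \<Union>\<S> \<Longrightarrow> card (l \<inter> e) = 1"
  shows "e \<in> \<Union>\<L>"
proof (rule ccontr)
  assume not_line: "e \<notin> \<Union>\<L>"
  define R where "R = \<L> - \<S>"
  have fin\<L>: "finite \<L>" by (rule net_finite_classes[OF net])
  have "card \<L> = s + 1" using net by (simp add: net_def)
  then have cardR: "card R = h"
    using \<S> card_Diff_subset[of \<S> \<L>] finite_subset[OF \<S>(1) fin\<L>] by (simp add: R_def)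
  have finR: "finite R" using fin\<L> by (simp add: R_def)
  have fine: "finite e" using e(2) s by (intro card_ge_0_finite) simp
  have joined: "\<exists>c l. c \<in> R \<and> l \<in> c \<and> p \<in> l \<and> q \<in> l" if pq: "p \<in> e" "q \<in> e" "p \<noteq> q" for p q
  proof -
    have "p \<in> P" "q \<in> P" using pq e(1) by auto
    then obtain l where l: "l \<in> \<Union>\<L>" "p \<in> l" "q \<in> l"
      using plane_line_through_two_points[OF net s _ _ pq(3)] by metis
    then obtain c where c: "c \<in> \<L>" "l \<in> c" by blast
    have "c \<notin> \<S>"
    proof
      assume "c \<in> \<S>"
      then have "card (l \<inter> e) = 1"
        using e(3) c by blast
      then obtain r where "l \<inter> e = {r}"
        by (auto simp: card_1_singleton_iff)
      then show False
        using l pq by (metis IntI singletonD)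
    qed
    then show ?thesis
      using c l by (auto simp: R_def)
  qed
  have few: "card (l \<inter> e) + 1 \<le> h" if c: "c \<in> R" "l \<in> c" for c l
  proof -
    have l: "l \<in> \<Union>\<L>" using c by (auto simp: R_def)
    have "\<not> e \<subseteq> l"
      using card_subset_eq[of l e] net_line_subset[OF net l] e(2) not_line l by auto
    then obtain p where p: "p \<in> e" "p \<notin> l" by blast
    have "\<exists>d m. d \<in> R \<and> m \<in> d \<and> p \<in> m \<and> q \<in> m" if "q \<in> l \<inter> e" for q
      using joined[OF p(1), of q] that p(2) by blast
    then obtain g m where g: "\<And>q. q \<in> l \<inter> e \<Longrightarrow> g q \<in> R \<and> m q \<in> g q \<and> p \<in> m q \<and> q \<in> m q"
      by metis
    have ne: "g q \<noteq> c" if "q \<in> l \<inter> e" for q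
    proof
      assume "g q = c"
      then have "m q = l"
        using net_line_unique[OF net, of c "m q" l q] g[OF that] c that by (auto simp: R_def)
      then show False
        using g[OF that] p(2) by blast
    qed
    have "inj_on g (l \<inter> e)"
    proof (rule inj_onI)
      fix q r assume q: "q \<in> l \<inter> e" and r: "r \<in> l \<inter> e" and eq: "g q = g r"
      have "m q = m r"
        using net_line_unique[OF net, of "g q" "m q" "m r" p] g[OF q] g[OF r] eq
        by (auto simp: R_def)
      then have "q \<in> l \<inter> m q" "r \<in> l \<inter> m q"
        using g[OF q] g[OF r] q r by auto
      moreover have "card (l \<inter> m q) = 1"
        using net_lines_meet[OF net, of c "g q" l "m q"] g[OF q] ne[OF q] c by (auto simp: R_def)
      ultimately show "q = r"
        by (metis card_1_singletonE singletonD)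
    qed
    then have "card (l \<inter> e) \<le> card (R - {c})"
      using g ne finR by (intro card_inj_on_le[of g]) auto
    then show ?thesis
      using card_Suc_Diff1[OF finR c(1)] cardR by linarith
  qed
  obtain p where p: "p \<in> e"
    using e(2) s by fastforce
  have "\<exists>l. l \<in> c \<and> p \<in> l" if "c \<in> R" for c
    using net_line_through[OF net, of c p] that p e(1) by (auto simp: R_def)
  then obtain L where L: "\<And>c. c \<in> R \<Longrightarrow> L c \<in> c \<and> p \<in> L c"
    by metis
  have "e - {p} \<subseteq> (\<Union>c\<in>R. L c \<inter> e - {p})"
  proof
    fix q assume q: "q \<in> e - {p}"
    then obtain c l where c: "c \<in> R" "l \<in> c" "p \<in> l" "q \<in> l"
      using joined[OF p, of q] by blast
    then have "l = L c"
      using net_line_unique[OF net, of c l "L c" p] L[OF c(1)] by (auto simp: R_def)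
    then show "q \<in> (\<Union>c\<in>R. L c \<inter> e - {p})"
      using c q by blast
  qed
  then have "card (e - {p}) \<le> card (\<Union>c\<in>R. L c \<inter> e - {p})"
    using finR fine by (intro card_mono) auto
  also have "\<dots> \<le> (\<Sum>c\<in>R. card (L c \<inter> e - {p}))"
    by (rule card_UN_le[OF finR])
  also have "\<dots> \<le> (\<Sum>c\<in>R. h - 2)"
  proof (rule sum_mono)
    fix c assume c: "c \<in> R"
    have "card (L c \<inter> e - {p}) = card (L c \<inter> e) - 1"
      using L[OF c] p fine by (intro card_Diff_singleton) auto
    then show "card (L c \<inter> e - {p}) \<le> h - 2"
      using few[OF c, of "L c"] L[OF c] by simp
  qed
  finally have le: "s - 1 \<le> h * (h - 2)"
    using cardR p fine e(2) by simp
  \<comment> \<open>For h < 2 the truncated product h * (h - 2) is 0, below s - 1. With h = k + 2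
    the bound s - 1 <= (k + 2) k reads s <= (k + 1)^2 = (h - 1)^2.\<close>
  have "2 \<le> h"
    using le s by (cases "2 \<le> h") auto
  then obtain k where k: "h = k + 2"
    by (metis add.commute le_Suc_ex)
  have "s \<le> (k + 1)\<^sup>2"
    using le s unfolding k by (simp add: power2_eq_square)
  then have "int s \<le> (int k + 1)\<^sup>2"
    by (metis of_nat_1 of_nat_add of_nat_le_iff of_nat_power)
  also have "\<dots> \<le> (int d - 1)\<^sup>2"
    using h(1) k by (intro power_mono) auto
  finally show False using h(2) by simp
qed

text \<open>Each class covers every point exactly once, so the difference of the indicators of two
  full classes is balanced. A row basis thus contains at most one full class entirely and misses an
  edge of each of the others. This complements the bound in \<open>special_classes\<close>.\<close>

lemma full_classes_rank:
  fixes F :: "'v::finite set set"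
  assumes net: "net s a P \<L>" and s: "2 \<le> s" and \<K>: "\<K> \<subseteq> \<L>" "\<Union>\<K> \<subseteq> F"
  shows "incidence_rank F + card \<K> \<le> card F + 1"
proof -
  obtain G where G: "G \<subseteq> F" "row_independent G" "card G = incidence_rank F"
    by (rule row_basis_exists)
  have disj: "c \<inter> d = {}" if "c \<in> \<K>" "d \<in> \<K>" "c \<noteq> d" for c d
    using net_classes_disjoint[OF net] s \<K>(1) that by auto
  have one: "c = d" if "c \<in> \<K>" "d \<in> \<K>" "c \<subseteq> G" "d \<subseteq> G" for c d
  proof (rule ccontr)
    assume "c \<noteq> d"
    define x :: "'v set \<Rightarrow> real" where
      "x e = (if e \<in> c then 1 else 0) - (if e \<in> d then 1 else 0)" for e
    have count: "(\<Sum>e | e \<in> G \<and> v \<in> e. if e \<in> b then 1 else 0) = (if v \<in> P then 1 else (0::real))"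
      if "b \<in> \<K>" "b \<subseteq> G" for b v
    proof (cases "v \<in> P")
      case True
      have b: "b \<in> \<L>" using \<K>(1) that(1) by blast
      obtain l where l: "l \<in> b" "v \<in> l"
        using net_line_through[OF net b True] .
      have "{e. e \<in> G \<and> v \<in> e} \<inter> b = {l}"
        using l that net_line_unique[OF net _ _ l(1) _ l(2)] \<K>(1) by blast
      then show ?thesis
        using True by (simp add: sum.If_cases)
    next
      case False
      then have "{e. e \<in> G \<and> v \<in> e} \<inter> b = {}"
        using net_line_subset(1)[OF net] \<K>(1) that(1) by blast
      then show ?thesis
        using False by (simp add: sum.If_cases)
    qed
    have "balanced G x"
      unfolding balanced_def x_def using count[OF that(1,3)] count[OF that(2,4)]
      by (simp add: sum_subtractf)
    moreover obtain l where l: "l \<in> c"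
    proof -
      have "card c = s"
        using net \<K>(1) \<open>c \<in> \<K>\<close> by (auto simp: net_def)
      then have "c \<noteq> {}" using s by auto
      then show ?thesis using that by blast
    qed
    moreover have "x l = 1"
      using l disj[OF that(1,2) \<open>c \<noteq> d\<close>] by (auto simp: x_def)
    ultimately show False
      using G(2) that(3) unfolding row_independent_def by (metis subsetD zero_neq_one)
  qed
  define M where "M = {c \<in> \<K>. \<not> c \<subseteq> G}"
  have "card (\<K> - M) \<le> 1"
  proof -
    have "\<forall>c\<in>\<K> - M. \<forall>d\<in>\<K> - M. c = d"
      using one by (auto simp: M_def)
    moreover have "finite (\<K> - M)"
      using finite_subset[OF \<K>(1) net_finite_classes[OF net]] by blast
    ultimately show ?thesis
      using card_le_Suc0_iff_eq[of "\<K> - M"] by simp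
  qed
  then have cardM: "card \<K> \<le> card M + 1"
    using card_Un_le[of M "\<K> - M"] by (simp add: M_def Un_absorb1 Un_Diff_cancel)
  have "\<exists>e. e \<in> c - G" if "c \<in> M" for c
    using that by (auto simp: M_def)
  then obtain r where r: "\<And>c. c \<in> M \<Longrightarrow> r c \<in> c - G"
    by metis
  have "inj_on r M"
  proof (rule inj_onI)
    fix c d assume "c \<in> M" "d \<in> M" "r c = r d"
    then show "c = d"
      using r[of c] r[of d] disj[of c d] by (auto simp: M_def)
  qed
  then have "card M \<le> card (F - G)"
    using r \<K>(2) by (intro card_inj_on_le[of r]) (auto simp: M_def)
  also have "\<dots> = card F - card G"
    using G(1) by (intro card_Diff_subset) auto
  finally show ?thesis
    using cardM G(3) card_mono[OF _ G(1)] by simp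
qed

text \<open>The net formed by the s-edge blocks fixes the plane, but h is read off from
  \<open>\<K>\<close>, all plane classes contained in F. Since \<open>\<S> \<subseteq> \<K>\<close>,
  the bounds in \<open>special_classes\<close> and \<open>full_classes_rank\<close> pinch the kernel
  dimension to \<open>card \<K>\<close> - 1, so the defect equals h plus the number of edges outside
  \<open>\<K>\<close>.\<close>

lemma affine_subsystem_if_special:
  fixes F :: "'v::finite set set"
  assumes F: "uniform s F" "linear_hypergraph F" and s: "2 \<le> s"
    and sp: "special_classes s F \<S>"
    and D: "rank_defect s F \<le> int D" "int D \<le> int s - 1" "Comp s D"
  shows "\<exists>h. affine_subsystem s h F"
proof -
  define \<S>0 where "\<S>0 = {C \<in> \<S>. card C = s}"
  let ?a = "card \<S>0"
  define h0 where "h0 = s + 1 - ?a"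
  have co: "\<S>0 \<subseteq> rel_components F disjnt"
    using sp by (auto simp: \<S>0_def special_classes_def)
  have class0: "card C = s \<and> pairwise disjnt C" if "C \<in> \<S>0" for C
    using sp that by (auto simp: \<S>0_def special_classes_def)
  have a: "int s + 1 - int ?a \<le> int D"
    using special_defect[OF sp] D(1) by (simp add: \<S>0_def)
  \<comment> \<open>Without such blocks the defect would be at least s + 1, above D.\<close>
  have ne: "\<S>0 \<noteq> {}"
    using a D(2) by (intro notI) simp
  define V where "V = \<Union>F"
  have net0: "net s ?a V \<S>0"
    unfolding V_def by (rule special_net[OF F(1,2) _ co class0 ne]) (use s in simp)
  have "?a \<le> s + 1"
    by (rule net_card_le[OF net0 s])
  then have h0: "?a + h0 = s + 1" "h0 \<le> D"
    using a by (auto simp: h0_def)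
  obtain \<L> where net: "net s (s + 1) V \<L>" and \<S>\<L>: "\<S>0 \<subseteq> \<L>"
    using Comp_extend[OF D(3) net0] a by (auto simp: deficiency_def)
  have big: "int s > (int D - 1)\<^sup>2"
    using D(3) by (simp add: Comp_def)
  define L where "L = \<Union>\<L>"
  have UL: "\<Union>L = V"
    unfolding L_def using net_points[OF net] \<S>\<L> ne by blast
  have s1: "s \<noteq> 1" using s by simp
  have transversal: "e \<in> L" if "e \<subseteq> V" "card e = s" "\<And>l. l \<in> \<Union>\<S>0 \<Longrightarrow> card (l \<inter> e) = 1" for e
    unfolding L_def by (rule transversal_is_line[OF net s \<S>\<L> h0 big that])
  have planeL: "is_affine_plane s L"
    unfolding is_affine_plane_def using net UL L_def by blast
  have FL: "F \<subseteq> L"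
  proof
    fix f assume f: "f \<in> F"
    show "f \<in> L"
    proof (cases "f \<in> \<Union>\<S>0")
      case True
      then show ?thesis using \<S>\<L> by (auto simp: L_def)
    next
      case False
      obtain E where E: "E \<in> rel_components F disjnt" "f \<in> E"
        using rel_component_exists[OF f] .
      have "card (l \<inter> f) = 1" if l: "l \<in> \<Union>\<S>0" for l
      proof -
        obtain C where C: "C \<in> \<S>0" "l \<in> C" using l by blast
        then have "C \<noteq> E" using False E by blast
        then show ?thesis
          using meet_form_co_components(1)[OF F(2,1) _ E(1) _ C(2) E(2)] C(1) co by blast
      qed
      then show ?thesis
        using F(1) f by (intro transversal) (auto simp: V_def uniform_def)
    qed
  qed
  have S0F: "\<Union>\<S>0 \<subseteq> F"
    using co rel_component_subset by blast
  \<comment> \<open>A plane L' containing F has the same points and contains the classes of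
    \<open>\<S>0\<close> as whole parallel classes, since disjoint lines of L' are parallel. Its
    other lines are transversals of \<open>\<S>0\<close>, hence lines of L, and both planes have the
    same number of lines.\<close>
  have unique: "L' = L" if L': "is_affine_plane s L'" "F \<subseteq> L'" for L'
  proof -
    obtain \<C> where \<C>: "net s (s + 1) (\<Union>L') \<C>" "L' = \<Union>\<C>"
      using L'(1) unfolding is_affine_plane_def by blast
    have "V \<subseteq> \<Union>L'" using L'(2) by (auto simp: V_def)
    moreover have "card V = card (\<Union>L')" "finite (\<Union>L')"
      using \<C>(1) net by (auto simp: net_def)
    ultimately have V: "\<Union>L' = V"
      using card_subset_eq by metis
    have "l \<in> L" if l: "l \<in> L'" for l
    proof (cases "l \<in> \<Union>\<S>0")
      case True
      then show ?thesis using \<S>\<L> by (auto simp: L_def)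
    next
      case False
      obtain c where c: "c \<in> \<C>" "l \<in> c" using l \<C>(2) by blast
      have "card (k \<inter> l) = 1" if k: "k \<in> \<Union>\<S>0" for k
      proof -
        obtain C where C: "C \<in> \<S>0" "k \<in> C" using k by blast
        obtain d where d: "d \<in> \<C>" "k \<in> d" using k S0F L'(2) \<C>(2) by blast
        have "C \<subseteq> d"
        proof
          fix m assume m: "m \<in> C"
          then obtain d' where d': "d' \<in> \<C>" "m \<in> d'"
            using C(1) S0F L'(2) \<C>(2) by blast
          show "m \<in> d"
          proof (cases "m = k")
            case False
            then have "disjnt k m"
              using class0[OF C(1)] C(2) m by (auto simp: pairwise_def)
            then show ?thesis
              using net_disjnt_same_class[OF \<C>(1) d(1) d'(1) d(2) d'(2)] d'(2) by simp
          qed (use d in simp)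
        qed
        then have "C = d"
          using class0[OF C(1)] net_class_finite[OF \<C>(1) d(1)] \<C>(1) d(1)
          by (intro card_subset_eq) (auto simp: net_def)
        then have "d \<noteq> c" using False C c by blast
        then show ?thesis
          using net_lines_meet[OF \<C>(1) d(1) c(1) _ d(2) c(2)] by simp
      qed
      then show ?thesis
        using net_line_subset[OF \<C>(1), of l] c V by (intro transversal) auto
    qed
    then have "L' \<subseteq> L" by blast
    moreover have "card L' = card L" "finite L"
      using net_card_lines[OF \<C>(1) s1 subset_refl] net_card_lines[OF net s1 subset_refl] \<C> net
      by (auto simp: net_def L_def)
    ultimately show ?thesis by (simp add: card_subset_eq)
  qed
  define \<K> where "\<K> = {c \<in> \<L>. c \<subseteq> F}"
  have \<K>: "\<K> \<subseteq> \<L>" "\<Union>\<K> \<subseteq> F" by (auto simp: \<K>_def)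
  have card\<L>: "card \<L> = s + 1" "finite \<L>"
    using net net_finite_classes[OF net] by (auto simp: net_def)
  then have card\<K>: "card \<K> \<le> s + 1"
    using card_mono[OF _ \<K>(1)] by simp
  \<comment> \<open>Disjoint lines of the plane are parallel, so a block, being connected under
    disjointness, stays within one parallel class. Having at least s edges, it is the whole
    class.\<close>
  have "\<S> \<subseteq> \<K>"
  proof
    fix C assume "C \<in> \<S>"
    then have C: "C \<in> rel_components F disjnt" "s \<le> card C"
      using sp by (auto simp: special_classes_def)
    have CF: "C \<subseteq> F" by (rule rel_component_subset[OF C(1)])
    obtain e where e: "e \<in> C" using C(2) s by fastforce
    then obtain c where c: "c \<in> \<L>" "e \<in> c"
      using CF FL by (auto simp: L_def)
    have "C \<inter> c = C"
    proof (rule ccontr)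
      assume "C \<inter> c \<noteq> C"
      then have "C \<inter> c \<subseteq> C \<and> C \<inter> c \<noteq> {} \<and> C \<inter> c \<noteq> C"
        using e c by blast
      then obtain f g where fg: "f \<in> C \<inter> c" "g \<in> C - C \<inter> c" "disjnt f g"
        using cut_connected_rel_component[OF symp_disjnt C(1)] unfolding cut_connected_def by meson
      then obtain d where "d \<in> \<L>" "g \<in> d"
        using CF FL by (auto simp: L_def)
      then show False
        using net_disjnt_same_class[OF net c(1), of d f g] fg by blast
    qed
    then have "C = c"
      using C(2) net_class_finite[OF net c(1)] c(1) net
      by (intro card_seteq) (auto simp: net_def)
    then show "C \<in> \<K>"
      using c CF by (simp add: \<K>_def)
  qed
  then have "card \<S> \<le> card \<K>"
    using card\<L>(2) \<K>(1) by (intro card_mono) (auto intro: finite_subset)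
  then have "card F + 1 \<le> incidence_rank F + card \<K>"
    using sp by (simp add: special_classes_def)
  then have rank: "incidence_rank F + card \<K> = card F + 1"
    using full_classes_rank[OF net s \<K>] by simp
  have cardF: "card F = card \<K> * s + card (F - \<Union>\<K>)"
    using card_Diff_subset[OF net_card_lines(2)[OF net s1 \<K>(1)] \<K>(2)]
      net_card_lines(1)[OF net s1 \<K>(1)] card_mono[OF _ \<K>(2)] by simp
  define h where "h = s + 1 - card \<K>"
  have h: "card \<K> + h = s + 1"
    using card\<K> by (simp add: h_def)
  have defect: "rank_defect s F = int h + int (card (F - \<Union>\<K>))"
  proof -
    have r: "int (incidence_rank F) = int (card F) + 1 - int (card \<K>)"
      using rank by linarith
    have hh: "int h = int s + 1 - int (card \<K>)"
      using h by linarith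
    show ?thesis
      unfolding rank_defect_def r hh cardF by (simp add: algebra_simps)
  qed
  have "affine_subsystem s h F"
    unfolding affine_subsystem_def
  proof (intro conjI exI)
    show "int h \<le> rank_defect s F" using defect by simp
    show "\<exists>!L. is_affine_plane s L \<and> F \<subseteq> L"
      using planeL FL unique by blast
    show "net s (s + 1) (\<Union>L) \<L>" using net UL by simp
    show "L = \<Union>\<L>" by (rule L_def)
    show "int (card (F - \<Union>\<K>)) = rank_defect s F - int h" using defect by simp
  qed (use FL \<K> h in auto)
  then show ?thesis ..
qed

section \<open>The decomposition theorem\<close>

text \<open>A plane has s(s + 1) lines, and F has s(s + 1 - h) lines in full classes besides the d -
  h additional ones. The condition h <= s leaves at least one full class; it already covers all
  points of the plane, and the full classes form a net.\<close>

lemma affine_subsystem_completion: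
  fixes F :: "'v::finite set set"
  assumes "affine_subsystem s h F" "2 \<le> s"
  shows "is_affine_plane s (plane_completion s F)" "F \<subseteq> plane_completion s F"
    and "int (card (plane_completion s F - F)) = int h * (int s + 1) - rank_defect s F"
    and "\<And>L. is_affine_plane s L \<Longrightarrow> F \<subseteq> L \<Longrightarrow> plane_completion s F = L"
    and "h \<le> s \<Longrightarrow> \<Union>(plane_completion s F) = \<Union>F"
    and "h \<le> s \<Longrightarrow> \<exists>G\<subseteq>F. is_net s G \<and> int (card (F - G)) = rank_defect s F - int h"
proof -
  have ex1: "\<exists>!L. is_affine_plane s L \<and> F \<subseteq> L"
    using assms(1) by (simp add: affine_subsystem_def)
  obtain L \<C> \<K> where net: "net s (s + 1) (\<Union>L) \<C>" and L: "L = \<Union>\<C>" "F \<subseteq> L"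
    and \<K>: "\<K> \<subseteq> \<C>" "card \<K> + h = s + 1" "\<Union>\<K> \<subseteq> F"
    and extra: "int (card (F - \<Union>\<K>)) = rank_defect s F - int h"
    using assms(1) unfolding affine_subsystem_def by (elim conjE exE) (rule that)
  have plane: "is_affine_plane s L"
    using net L(1) unfolding is_affine_plane_def by blast
  show unique: "plane_completion s F = M" if "is_affine_plane s M" "F \<subseteq> M" for M
    unfolding plane_completion_def using the1_equality[OF ex1] that by blast
  have pc: "plane_completion s F = L"
    by (rule unique[OF plane L(2)])
  show "is_affine_plane s (plane_completion s F)" "F \<subseteq> plane_completion s F"
    using plane L(2) by (simp_all add: pc)
  have s1: "s \<noteq> 1" using assms(2) by simp
  have "card L = (s + 1) * s"
    using net_card_lines(1)[OF net s1 subset_refl] net L(1) by (simp add: net_def)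
  moreover have "card F = card \<K> * s + card (F - \<Union>\<K>)"
    using card_Diff_subset[OF _ \<K>(3)] net_card_lines(1)[OF net s1 \<K>(1)] card_mono[OF _ \<K>(3)] by simp
  moreover have "card (L - F) = card L - card F" "card F \<le> card L"
    using card_Diff_subset[OF _ L(2)] card_mono[OF _ L(2)] by simp_all
  ultimately have "int (card (L - F)) = (int s + 1) * int s - (int (card \<K>) * int s + int (card (F - \<Union>\<K>)))"
    by (simp add: of_nat_diff algebra_simps)
  moreover have "int (card \<K>) = int s + 1 - int h"
    using \<K>(2) by linarith
  ultimately show "int (card (plane_completion s F - F)) = int h * (int s + 1) - rank_defect s F"
    unfolding pc using extra by (simp add: algebra_simps)
  assume "h \<le> s"
  then have ne: "\<K> \<noteq> {}"
    using \<K>(2) by auto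
  have pts: "\<Union>(\<Union>\<K>) = \<Union>L"
    by (rule net_points[OF net_subset[OF net \<K>(1)] ne])
  then show "\<Union>(plane_completion s F) = \<Union>F"
    unfolding pc using \<K>(3) L(2) by blast
  have "is_net s (\<Union>\<K>)"
    unfolding is_net_def pts using net_subset[OF net \<K>(1)] by blast
  then show "\<exists>G\<subseteq>F. is_net s G \<and> int (card (F - G)) = rank_defect s F - int h"
    using \<K>(3) extra by blast
qed

lemma vertex_disjoint_components: "vertex_disjoint (components_of_hypergraph E)"
  unfolding vertex_disjoint_def components_of_hypergraph_eq
proof (rule pairwiseI)
  fix F G assume FG: "F \<in> rel_components E line_adj" "G \<in> rel_components E line_adj" "F \<noteq> G"
  have "e \<inter> f = {}" if "e \<in> F" "f \<in> G" for e f
    using rel_components_separated[OF symp_line_adj FG that]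
      rel_components_disjoint[OF symp_line_adj FG] that by (auto simp: line_adj_def)
  then show "disjnt (\<Union>F) (\<Union>G)"
    unfolding disjnt_def by blast
qed

theorem corollary5p4:
  fixes E :: "'v::finite set set" and s D :: nat
  assumes "uniform s E"
    and "linear_hypergraph E"
    and "cograph E line_adj"
    and "rank_defect s E \<le> int D"
    and "int D \<le> int s - 1"
    and "Comp s D"
  shows
    (* (a) *)
    "(\<Union>(components_of_hypergraph E) = E \<and>
      vertex_disjoint (components_of_hypergraph E) \<and>
      (\<forall>F\<in>components_of_hypergraph E.
         is_affine_plane s F \<or> full_row_rank F \<or> (\<exists>h. affine_subsystem s h F)) \<and>
      (\<Sum>F\<in>{F \<in> components_of_hypergraph E. rank_defect s F > 0}. rank_defect s F) \<le> int D)
     \<and>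
     (\<exists>X\<subseteq>E. card X \<le> D \<and>
        (\<exists>\<N>. \<Union>\<N> = E - X \<and> vertex_disjoint \<N> \<and>
           (\<forall>L\<in>\<N>. is_net s L \<or> is_affine_plane s L)))
     \<and>
     ((\<forall>F\<in>geometric_components s E.
         is_affine_plane s (plane_completion s F) \<and> F \<subseteq> plane_completion s F \<and>
         \<Union>(plane_completion s F) = \<Union>F) \<and>
      (\<Sum>F\<in>geometric_components s E. card (plane_completion s F - F)) \<le> s * D \<and>
      (\<forall>F\<in>components_of_hypergraph E. \<forall>h. has_parameter s h F \<longrightarrow>
         int (card (plane_completion s F - F)) = int h * int s - (rank_defect s F - int h) \<and>
         int h * int s - (rank_defect s F - int h) = int h * (int s + 1) - rank_defect s F))"
proof -
  let ?co = "components_of_hypergraph E"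
  note co_eq = components_of_hypergraph_eq[of E]
  have s0: "0 < s" using assms(5) by linarith
  have part: "partition_on E ?co"
    unfolding co_eq by (rule partition_on_rel_components[OF symp_line_adj])
  have comp: "uniform s F" "linear_hypergraph F" "cograph F line_adj" "cut_connected F line_adj"
    "F \<subseteq> E" "F \<noteq> {}" if "F \<in> ?co" for F
  proof -
    have F: "F \<in> rel_components E line_adj" using that by (simp add: co_eq)
    show FE: "F \<subseteq> E" by (rule rel_component_subset[OF F])
    show "uniform s F" "linear_hypergraph F" "cograph F line_adj"
      using assms(1-3) FE uniform_mono linear_hypergraph_mono cograph_mono by blast+
    show "cut_connected F line_adj"
      by (rule cut_connected_rel_component[OF symp_line_adj F])
    show "F \<noteq> {}"
      using partition_onD3[OF part] that by metis
  qed
  \<comment> \<open>The case s = 1 falls under row independence, since distinct singletons have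
    independent rows.\<close>
  have cases: "row_independent F \<or> 2 \<le> s \<and> (int s \<le> rank_defect s F \<or> (\<exists>\<S>. special_classes s F \<S>))"
    if "F \<in> ?co" for F
    using special_classes_or_large_defect[OF comp(1,2)[OF that] s0 comp(3,4)[OF that]]
      row_independent_one_uniform[of F] comp(1)[OF that] s0 by (cases "s = 1") auto
  have nonneg: "0 \<le> rank_defect s F" if "F \<in> ?co" for F
    using cases[OF that] rank_defect_row_independent[of F s]
      special_defect_nonneg[OF comp(1,2)[OF that]] by fastforce
  have "(\<Sum>F\<in>?co. rank_defect s F) \<le> rank_defect s E"
    unfolding co_eq by (rule rank_defect_components)
  then have total: "(\<Sum>F\<in>?co. rank_defect s F) \<le> int D"
    using assms(4) by simp
  have le_D: "rank_defect s F \<le> int D" if "F \<in> ?co" for F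
    using member_le_sum[of F ?co "rank_defect s"] that nonneg total by fastforce
  have subsystem: "\<exists>h. affine_subsystem s h F" if F: "F \<in> ?co" "\<not> row_independent F" for F
  proof -
    have s2: "2 \<le> s" using cases F by blast
    obtain \<S> where "special_classes s F \<S>"
      using cases[OF F(1)] F(2) le_D[OF F(1)] assms(5) by fastforce
    then show ?thesis
      using affine_subsystem_if_special[OF comp(1,2)[OF F(1)] s2 _ le_D[OF F(1)] assms(5,6)]
      by blast
  qed
  \<comment> \<open>A component with independent rows has its number of edges as defect. This is
    positive, so 1 <= D <= s - 1.\<close>
  have s2: "2 \<le> s" if "F \<in> ?co" for F
  proof (cases "row_independent F")
    case True
    have "0 < card F"
      using comp(6)[OF that] by (simp add: card_gt_0_iff)
    then have "0 < int D"
      using le_D[OF that] True by (simp add: rank_defect_row_independent)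
    then show ?thesis using assms(5) by linarith
  qed (use cases that in blast)
  have h_le: "int h \<le> rank_defect s F" "h \<le> s" if "F \<in> ?co" "affine_subsystem s h F" for F h
    using that le_D[OF that(1)] assms(5) by (auto simp: affine_subsystem_def)
  \<comment> \<open>The rank of a plane is not computed directly. The component is an affine
    subsystem that completes to itself, so the formula for the added lines gives h (s + 1) = d <= D
    < s + 1, whence h = 0 and d = 0.\<close>
  have plane_subsystem: "\<exists>h. affine_subsystem s h F" "rank_defect s F = 0" "plane_completion s F = F"
    if F: "F \<in> ?co" "is_affine_plane s F" for F
  proof -
    \<comment> \<open>Independent rows would make the defect equal to the number (s + 1) s of lines,
      which exceeds D.\<close>
    have "\<not> row_independent F"
    proof
      assume "row_independent F"
      moreover obtain \<C> where "net s (s + 1) (\<Union>F) \<C>" "F = \<Union>\<C>"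
        using F(2) unfolding is_affine_plane_def by blast
      then have "card F = (s + 1) * s"
        using net_card_lines(1)[of s "s + 1" "\<Union>F" \<C> \<C>] s2[OF F(1)] by (simp add: net_def)
      ultimately have "int ((s + 1) * s) \<le> int D"
        using le_D[OF F(1)] by (simp add: rank_defect_row_independent)
      moreover have "s \<le> (s + 1) * s" by simp
      ultimately show False using assms(5) by linarith
    qed
    then show ex: "\<exists>h. affine_subsystem s h F"
      using subsystem[OF F(1)] by blast
    then obtain h where h: "affine_subsystem s h F" by blast
    note c = affine_subsystem_completion[OF h s2[OF F(1)]]
    show pc: "plane_completion s F = F"
      by (rule c(4)[OF F(2) subset_refl])
    have eq: "int h * (int s + 1) = rank_defect s F"
      using c(3) by (simp add: pc)
    have "h = 0"
    proof (rule ccontr)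
      assume "h \<noteq> 0"
      then have "1 * (int s + 1) \<le> int h * (int s + 1)"
        by (intro mult_right_mono) auto
      then have "int s + 1 \<le> rank_defect s F"
        unfolding eq by simp
      then show False
        using le_D[OF F(1)] assms(5) by linarith
    qed
    then show "rank_defect s F = 0" using eq by simp
  qed
  have geo: "\<exists>h. affine_subsystem s h F" if "F \<in> ?co" "has_parameter s h F" for F h
    using that plane_subsystem(1)[OF that(1)] unfolding has_parameter_def by blast
  have added: "int (card (plane_completion s F - F)) = int h * (int s + 1) - rank_defect s F"
    if "F \<in> ?co" "has_parameter s h F" for F h
    using that(2) unfolding has_parameter_def
  proof
    assume "is_affine_plane s F \<and> h = 0"
    then show ?thesis
      using plane_subsystem(2,3)[OF that(1)] by simp
  next
    assume "affine_subsystem s h F"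
    then show ?thesis
      by (rule affine_subsystem_completion(3)) (rule s2[OF that(1)])
  qed
  have geo_co: "geometric_components s E \<subseteq> ?co"
    by (auto simp: geometric_components_def)
  have geo_sub: "\<exists>h. affine_subsystem s h F" if "F \<in> geometric_components s E" for F
    using that geo unfolding geometric_components_def by blast
  have a4: "(\<Sum>F\<in>{F \<in> ?co. rank_defect s F > 0}. rank_defect s F) \<le> int D"
    using sum_mono2[of ?co "{F \<in> ?co. rank_defect s F > 0}" "rank_defect s"] nonneg total by fastforce
  have a3: "\<forall>F\<in>?co. is_affine_plane s F \<or> full_row_rank F \<or> (\<exists>h. affine_subsystem s h F)"
    using subsystem full_row_rank_if_row_independent by blast
  have c1: "\<forall>F\<in>geometric_components s E.
      is_affine_plane s (plane_completion s F) \<and> F \<subseteq> plane_completion s F \<and>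
      \<Union>(plane_completion s F) = \<Union>F"
  proof
    fix F assume F: "F \<in> geometric_components s E"
    then obtain h where h: "affine_subsystem s h F"
      using geo_sub by blast
    have co: "F \<in> ?co" using F geo_co by blast
    then show "is_affine_plane s (plane_completion s F) \<and> F \<subseteq> plane_completion s F \<and>
      \<Union>(plane_completion s F) = \<Union>F"
      using affine_subsystem_completion(1,2)[OF h s2[OF co]]
        affine_subsystem_completion(5)[OF h s2[OF co] h_le(2)[OF co h]] by simp
  qed
  have c2: "(\<Sum>F\<in>geometric_components s E. card (plane_completion s F - F)) \<le> s * D"
  proof -
    have "(\<Sum>F\<in>geometric_components s E. int (card (plane_completion s F - F)))
        \<le> (\<Sum>F\<in>geometric_components s E. int s * rank_defect s F)"
    proof (rule sum_mono)
      fix F assume F: "F \<in> geometric_components s E"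
      then obtain h where h: "affine_subsystem s h F"
        using geo_sub by blast
      have co: "F \<in> ?co" using F geo_co by blast
      \<comment> \<open>From h <= d, the number h (s + 1) - d of added lines is at most s d.\<close>
      have "int h * (int s + 1) \<le> rank_defect s F * (int s + 1)"
        using h_le(1)[OF co h] by (intro mult_right_mono) auto
      then show "int (card (plane_completion s F - F)) \<le> int s * rank_defect s F"
        using affine_subsystem_completion(3)[OF h s2[OF co]] by (simp add: algebra_simps)
    qed
    also have "\<dots> \<le> (\<Sum>F\<in>?co. int s * rank_defect s F)"
      using geo_co nonneg by (intro sum_mono2) auto
    also have "\<dots> = int s * (\<Sum>F\<in>?co. rank_defect s F)"
      by (simp add: sum_distrib_left)
    also have "\<dots> \<le> int s * int D"
      using total by (intro mult_left_mono) auto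
    finally have "int (\<Sum>F\<in>geometric_components s E. card (plane_completion s F - F)) \<le> int (s * D)"
      by simp
    then show ?thesis by (simp only: of_nat_le_iff)
  qed
  have b: "\<exists>X\<subseteq>E. card X \<le> D \<and>
        (\<exists>\<N>. \<Union>\<N> = E - X \<and> vertex_disjoint \<N> \<and>
           (\<forall>L\<in>\<N>. is_net s L \<or> is_affine_plane s L))"
  proof -
    \<comment> \<open>A component with independent rows is deleted entirely, at a cost equal to its
      defect. Any other component keeps its full parallel classes and loses the d - h additional
      lines.\<close>
    have "\<exists>G\<subseteq>F. (G = {} \<or> is_net s G) \<and> int (card (F - G)) \<le> rank_defect s F"
      if co: "F \<in> ?co" for F
    proof (cases "row_independent F")
      case True
      then show ?thesis
        by (intro exI[of _ "{}"]) (simp add: rank_defect_row_independent)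
    next
      case False
      then obtain h where h: "affine_subsystem s h F"
        using subsystem[OF co] by blast
      obtain G where "G \<subseteq> F" "is_net s G" "int (card (F - G)) = rank_defect s F - int h"
        using affine_subsystem_completion(6)[OF h s2[OF co] h_le(2)[OF co h]] by metis
      then show ?thesis
        by (intro exI[of _ G]) simp
    qed
    then obtain keep where keep: "\<And>F. F \<in> ?co \<Longrightarrow> keep F \<subseteq> F"
      "\<And>F. F \<in> ?co \<Longrightarrow> keep F = {} \<or> is_net s (keep F)"
      "\<And>F. F \<in> ?co \<Longrightarrow> int (card (F - keep F)) \<le> rank_defect s F"
      by metis
    define X where "X = (\<Union>F\<in>?co. F - keep F)"
    \<comment> \<open>Entirely deleted components leave the empty set, which is not a net because s
      > 0; it is removed.\<close>
    define \<N> where "\<N> = keep ` ?co - {{}}"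
    have disj: "F \<inter> G = {}" if "F \<in> ?co" "G \<in> ?co" "F \<noteq> G" for F G
      using partition_onD2[OF part] that by (auto simp: disjoint_def)
    have "card X \<le> (\<Sum>F\<in>?co. card (F - keep F))"
      unfolding X_def by (rule card_UN_le) simp
    then have "int (card X) \<le> (\<Sum>F\<in>?co. int (card (F - keep F)))"
      by (metis of_nat_le_iff of_nat_sum)
    also have "\<dots> \<le> (\<Sum>F\<in>?co. rank_defect s F)"
      using keep(3) by (rule sum_mono)
    finally have "card X \<le> D"
      using total by simp
    moreover have "X \<subseteq> E"
      using comp(5) by (auto simp: X_def)
    moreover have "\<Union>\<N> = E - X"
    proof
      show "\<Union>\<N> \<subseteq> E - X"
      proof
        fix e assume "e \<in> \<Union>\<N>"
        then obtain F where F: "F \<in> ?co" "e \<in> keep F"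
          by (auto simp: \<N>_def)
        then have "e \<notin> G - keep G" if "G \<in> ?co" for G
          using disj[OF F(1) that] keep(1)[OF F(1)] by (cases "F = G") auto
        then show "e \<in> E - X"
          using F keep(1)[OF F(1)] comp(5)[OF F(1)] by (auto simp: X_def)
      qed
      show "E - X \<subseteq> \<Union>\<N>"
      proof
        fix e assume e: "e \<in> E - X"
        then obtain F where "F \<in> ?co" "e \<in> F"
          using rel_component_exists[of e E line_adj] by (auto simp: co_eq)
        then show "e \<in> \<Union>\<N>"
          using e by (auto simp: X_def \<N>_def)
      qed
    qed
    moreover have "vertex_disjoint \<N>"
      unfolding vertex_disjoint_def
    proof (rule pairwiseI)
      fix K M assume "K \<in> \<N>" "M \<in> \<N>" "K \<noteq> M"
      then obtain F G where FG: "F \<in> ?co" "K = keep F" "G \<in> ?co" "M = keep G" "F \<noteq> G"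
        by (auto simp: \<N>_def)
      then have "disjnt (\<Union>F) (\<Union>G)"
        using vertex_disjoint_components[of E] by (auto simp: vertex_disjoint_def pairwise_def)
      then show "disjnt (\<Union>K) (\<Union>M)"
        using keep(1)[OF FG(1)] keep(1)[OF FG(3)] FG(2,4) unfolding disjnt_def by blast
    qed
    moreover have "\<forall>L\<in>\<N>. is_net s L \<or> is_affine_plane s L"
      using keep(2) by (auto simp: \<N>_def)
    ultimately show ?thesis by blast
  qed
  have c3: "\<forall>F\<in>?co. \<forall>h. has_parameter s h F \<longrightarrow>
         int (card (plane_completion s F - F)) = int h * int s - (rank_defect s F - int h) \<and>
         int h * int s - (rank_defect s F - int h) = int h * (int s + 1) - rank_defect s F"
    using added by (simp add: algebra_simps)
  have a1: "\<Union>?co = E"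
    using partition_onD1[OF part] by (rule sym)
  show ?thesis
    by (intro conjI a1 vertex_disjoint_components a3 a4 b c1 c2 c3)
qed

end
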